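(* Let $0\le r_1,r_2,r_3\le n$ and $0\le s\le \min\big(\mathrm{N}(r_1,r_2),\mathrm{N}(r_2,r_3)\big)$. Then, with the normalized maps $\Lambda_s^{a,b}$ described in the context, $$\Lambda_s^{r_2,r_3}\circ\Lambda_s^{r_1,r_2}=\frac{\Big[\begin{smallmatrix} n\\ r_2\end{smallmatrix}\Big]_q}{\Big[\begin{smallmatrix} n\\ s\end{smallmatrix}\Big]_q-\Big[\begin{smallmatrix} n\\ s-1\end{smallmatrix}\Big]_q}\;\Lambda_s^{r_1,r_3},$$ with the convention $\Big[\begin{smallmatrix} n\\ -1\end{smallmatrix}\Big]_q=0$.
   Context: Let $q$ be a prime power, $\mathbb{K}=\mathbb{F}_q$, $\Omega$ an $n$-dimensional vector space over $\mathbb{K}$ and $\mathrm{G}=\mathrm{GL}(\Omega)$. For $0\le r\le n$ let $\mathrm{X}_r$ be the set of $r$-dimensional subspaces of $\Omega$. For subspaces $x,y$ write $\partial(x,y)=\dim(x/(x\cap y))$. Let $\mathrm{V}_r$ be the Hilbert space of functions $\mathrm{X}_r\to\mathbb{C}$ (standard inner product), with $\mathrm{G}$ acting by $(\rho_r(g)\varphi)(x)=\varphi(g^{-1}x)$. For $0\le r_1,r_2\le n$ put $\mathrm{N}(r_1,r_2)=\min(r_1,r_2,n-r_1,n-r_2)$ and $\mathrm{I}_n(r_1,r_2)=\{t\in\mathbb{Z}:\max(0,r_2-r_1)\le t\le\min(r_2,n-r_1)\}$ (the set of values of $\partial(x_2,x_1)$, $x_i\in\mathrm{X}_{r_i}$).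 A linear map $\Lambda:\mathrm{V}_{r_1}\to\mathrm{V}_{r_2}$ is $\mathrm{G}$-equivariant iff $\Lambda\varphi(x_2)=\sum_{x_1\in\mathrm{X}_{r_1}}\lambda(\partial(x_2,x_1))\varphi(x_1)$ for some $\lambda:\mathrm{I}_n(r_1,r_2)\to\mathbb{C}$ (its kernel). There are pairwise inequivalent irreducible representations $\pi_0,\pi_1,\dots$ of $\mathrm{G}$ such that each $\mathrm{V}_r$ is the orthogonal sum of irreducible $\mathrm{G}$-invariant subspaces $\mathrm{V}_r=\bigoplus_{s=0}^{\min(r,n-r)}\mathrm{V}_{r,s}$ with $\mathrm{V}_{r,s}$ equivalent to $\pi_s$. For $0\le s\le\mathrm{N}(r_1,r_2)$, $\Lambda_s^{r_1,r_2}$ is a nonzero $\mathrm{G}$-equivariant map $\mathrm{V}_{r_1,s}\to\mathrm{V}_{r_2,s}$ (unique up to scalar), regarded as a map $\mathrm{V}_{r_1}\to\mathrm{V}_{r_2}$ vanishing on the orthogonal complement of $\mathrm{V}_{r_1,s}$, with kernel $\lambda_s^{r_1,r_2}$. There is a unique polynomial $f_s^{r_1,r_2}$ of degree at most $s$ with $f_s^{r_1,r_2}(q^{-t})=\lambda_s^{r_1,r_2}(t)$ for $t\in\mathrm{I}_n(r_1,r_2)$, and $f_s^{r_1,r_2}(1)\neq0$; the maps are normalized by $f_s^{r_1,r_2}(1)=1$. Notation: $(u;p)_k=\prod_{j=0}^{k-1}(1-p^ju)$, $\Big[\begin{smallmatrix} m\\ k\end{smallmatrix}\Big]_q=\frac{(q;q)_m}{(q;q)_k(q;q)_{m-k}}$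 for $0\le k\le m$. *)

theory Defs
  imports
    Complex_Main
    "HOL-Library.Cardinality"
    "HOL-Library.Function_Algebras"
    "HOL-Computational_Algebra.Polynomial"
begin

section \<open>Gaussian binomial coefficients\<close>

definition q_pochhammer :: "'a::comm_ring_1 \<Rightarrow> 'a \<Rightarrow> nat \<Rightarrow> 'a" where
  "q_pochhammer u p k = (\<Prod>j<k. 1 - p ^ j * u)"

text \<open>Only used for \<open>k \<le> m\<close> and \<open>q\<close> not a root of unity.\<close>

definition q_binomial :: "'a::field \<Rightarrow> nat \<Rightarrow> nat \<Rightarrow> 'a" where
  "q_binomial q m k = q_pochhammer q q m / (q_pochhammer q q k * q_pochhammer q q (m - k))"


section \<open>Representations on subspaces of complex vector spaces\<close>

text \<open>
  A representation of a group \<open>G\<close> of permutations (of some type) is given by a scalar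
  multiplication \<open>sc\<close> on an ambient type, a carrier subspace \<open>U\<close>, and an action \<open>\<rho>\<close>.
  Nothing is required of \<open>\<rho>\<close> outside \<open>G\<close> and \<open>U\<close>.
\<close>

definition linear_map_on ::
    "(complex \<Rightarrow> 'a::ab_group_add \<Rightarrow> 'a) \<Rightarrow> (complex \<Rightarrow> 'b::ab_group_add \<Rightarrow> 'b) \<Rightarrow> 'a set \<Rightarrow> ('a \<Rightarrow> 'b) \<Rightarrow> bool"
  where "linear_map_on sc sc' U T \<longleftrightarrow>
    (\<forall>u\<in>U. \<forall>v\<in>U. T (u + v) = T u + T v) \<and> (\<forall>c. \<forall>u\<in>U. T (sc c u) = sc' c (T u))"

definition invariant_subspace ::
    "('g \<Rightarrow> 'g) set \<Rightarrow> (complex \<Rightarrow> 'a::ab_group_add \<Rightarrow> 'a) \<Rightarrow> (('g \<Rightarrow> 'g) \<Rightarrow> 'a \<Rightarrow> 'a) \<Rightarrow> 'a set \<Rightarrow> bool"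
  where "invariant_subspace G sc \<rho> U \<longleftrightarrow>
    module.subspace sc U \<and> (\<forall>g\<in>G. \<rho> g ` U \<subseteq> U)"

definition representation_on ::
    "('g \<Rightarrow> 'g) set \<Rightarrow> (complex \<Rightarrow> 'a::ab_group_add \<Rightarrow> 'a) \<Rightarrow> (('g \<Rightarrow> 'g) \<Rightarrow> 'a \<Rightarrow> 'a) \<Rightarrow> 'a set \<Rightarrow> bool"
  where "representation_on G sc \<rho> U \<longleftrightarrow>
    invariant_subspace G sc \<rho> U \<and>
    (\<forall>g\<in>G. linear_map_on sc sc U (\<rho> g)) \<and>
    (\<forall>u\<in>U. \<rho> id u = u) \<and>
    (\<forall>g\<in>G. \<forall>h\<in>G. \<forall>u\<in>U. \<rho> (g \<circ> h) u = \<rho> g (\<rho> h u))"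

definition irreducible_representation_on ::
    "('g \<Rightarrow> 'g) set \<Rightarrow> (complex \<Rightarrow> 'a::ab_group_add \<Rightarrow> 'a) \<Rightarrow> (('g \<Rightarrow> 'g) \<Rightarrow> 'a \<Rightarrow> 'a) \<Rightarrow> 'a set \<Rightarrow> bool"
  where "irreducible_representation_on G sc \<rho> U \<longleftrightarrow>
    representation_on G sc \<rho> U \<and> U \<noteq> {0} \<and>
    (\<forall>W. W \<subseteq> U \<and> invariant_subspace G sc \<rho> W \<longrightarrow> W = {0} \<or> W = U)"

definition equivariant_on ::
    "('g \<Rightarrow> 'g) set \<Rightarrow> (('g \<Rightarrow> 'g) \<Rightarrow> 'a \<Rightarrow> 'a) \<Rightarrow> (('g \<Rightarrow> 'g) \<Rightarrow> 'b \<Rightarrow> 'b) \<Rightarrow> 'a set \<Rightarrow> ('a \<Rightarrow> 'b) \<Rightarrow> bool"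
  where "equivariant_on G \<rho> \<rho>' U T \<longleftrightarrow> (\<forall>g\<in>G. \<forall>u\<in>U. T (\<rho> g u) = \<rho>' g (T u))"

definition equivalent_representations ::
    "('g \<Rightarrow> 'g) set \<Rightarrow>
     (complex \<Rightarrow> 'a::ab_group_add \<Rightarrow> 'a) \<Rightarrow> (('g \<Rightarrow> 'g) \<Rightarrow> 'a \<Rightarrow> 'a) \<Rightarrow> 'a set \<Rightarrow>
     (complex \<Rightarrow> 'b::ab_group_add \<Rightarrow> 'b) \<Rightarrow> (('g \<Rightarrow> 'g) \<Rightarrow> 'b \<Rightarrow> 'b) \<Rightarrow> 'b set \<Rightarrow> bool"
  where "equivalent_representations G sc \<rho> U sc' \<rho>' U' \<longleftrightarrow>
    (\<exists>T. linear_map_on sc sc' U T \<and> bij_betw T U U' \<and> equivariant_on G \<rho> \<rho>' U T)"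


section \<open>Grassmannians and their function spaces\<close>

definition GL :: "('k::field \<Rightarrow> 'v::ab_group_add \<Rightarrow> 'v) \<Rightarrow> ('v \<Rightarrow> 'v) set" where
  "GL scale = {g. Vector_Spaces.linear scale scale g \<and> bij g}"

definition grassmannian :: "('k::field \<Rightarrow> 'v::ab_group_add \<Rightarrow> 'v) \<Rightarrow> nat \<Rightarrow> 'v set set" where
  "grassmannian scale r = {x. module.subspace scale x \<and> vector_space.dim scale x = r}"

text \<open>
  \<open>\<partial>(x,y) = dim (x/(x \<inter> y))\<close>, the dimension of the quotient being written as a difference
  of dimensions (the ambient space is finite-dimensional and \<open>x \<inter> y\<close> is a subspace of \<open>x\<close>, so
  the subtraction does not truncate).
\<close>

definition codist :: "('k::field \<Rightarrow> 'v::ab_group_add \<Rightarrow> 'v) \<Rightarrow> 'v set \<Rightarrow> 'v set \<Rightarrow> nat" where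
  "codist scale x y = vector_space.dim scale x - vector_space.dim scale (x \<inter> y)"

definition fscale :: "complex \<Rightarrow> ('x \<Rightarrow> complex) \<Rightarrow> ('x \<Rightarrow> complex)" where
  "fscale c \<phi> = (\<lambda>x. c * \<phi> x)"

lemma vector_space_fscale: "vector_space (fscale :: complex \<Rightarrow> ('x \<Rightarrow> complex) \<Rightarrow> _)"
  by unfold_locales (auto simp: fscale_def fun_eq_iff algebra_simps)

text \<open>A function on the \<open>r\<close>-dimensional subspaces is encoded by its extension by \<open>0\<close>.\<close>

definition fun_space :: "('k::field \<Rightarrow> 'v::ab_group_add \<Rightarrow> 'v) \<Rightarrow> nat \<Rightarrow> ('v set \<Rightarrow> complex) set" where
  "fun_space scale r = {\<phi>. \<forall>x. x \<notin> grassmannian scale r \<longrightarrow> \<phi> x = 0}"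

definition fun_inner ::
    "('k::field \<Rightarrow> 'v::ab_group_add \<Rightarrow> 'v) \<Rightarrow> nat \<Rightarrow> ('v set \<Rightarrow> complex) \<Rightarrow> ('v set \<Rightarrow> complex) \<Rightarrow> complex"
  where "fun_inner scale r \<phi> \<psi> = (\<Sum>x\<in>grassmannian scale r. \<phi> x * cnj (\<psi> x))"

text \<open>With functions extended by \<open>0\<close>, the same formula serves for every \<open>r\<close>.\<close>

definition fun_action :: "('v \<Rightarrow> 'v) \<Rightarrow> ('v set \<Rightarrow> complex) \<Rightarrow> ('v set \<Rightarrow> complex)" where
  "fun_action g \<phi> = (\<lambda>x. \<phi> (inv g ` x))"

definition orthogonal_sum ::
    "('k::field \<Rightarrow> 'v::ab_group_add \<Rightarrow> 'v) \<Rightarrow> nat \<Rightarrow> nat \<Rightarrow> (nat \<Rightarrow> ('v set \<Rightarrow> complex) set) \<Rightarrow> bool"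
  where "orthogonal_sum scale r m U \<longleftrightarrow>
    (\<forall>s\<le>m. module.subspace fscale (U s)) \<and>
    (\<forall>s\<le>m. \<forall>s'\<le>m. s \<noteq> s' \<longrightarrow> (\<forall>\<phi>\<in>U s. \<forall>\<psi>\<in>U s'. fun_inner scale r \<phi> \<psi> = 0)) \<and>
    fun_space scale r = {(\<Sum>s\<le>m. \<phi> s) |\<phi>. \<forall>s\<le>m. \<phi> s \<in> U s}"

text \<open>
  The decomposition \<open>V\<^sub>r = \<Oplus>\<^sub>s V\<^sub>r\<^sub>,\<^sub>s\<close> with \<open>V\<^sub>r\<^sub>,\<^sub>s\<close> equivalent to \<open>\<pi>\<^sub>s\<close>.  The representation \<open>\<pi>\<^sub>s\<close> has
  carrier \<open>P s\<close> (in an ambient complex vector space with scalar multiplication \<open>scP\<close>) and action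
  \<open>\<pi> s\<close>.  Only the indices \<open>s \<le> n div 2\<close> occur in the decompositions.
\<close>

definition grassmann_decomposition ::
    "('k::field \<Rightarrow> 'v::ab_group_add \<Rightarrow> 'v) \<Rightarrow> nat \<Rightarrow>
     (complex \<Rightarrow> 'p::ab_group_add \<Rightarrow> 'p) \<Rightarrow> (nat \<Rightarrow> ('v \<Rightarrow> 'v) \<Rightarrow> 'p \<Rightarrow> 'p) \<Rightarrow> (nat \<Rightarrow> 'p set) \<Rightarrow>
     (nat \<Rightarrow> nat \<Rightarrow> ('v set \<Rightarrow> complex) set) \<Rightarrow> bool"
  where "grassmann_decomposition scale n scP \<pi> P V \<longleftrightarrow>
    (\<forall>s\<le>n div 2. irreducible_representation_on (GL scale) scP (\<pi> s) (P s)) \<and>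
    (\<forall>s\<le>n div 2. \<forall>s'\<le>n div 2. s \<noteq> s' \<longrightarrow>
      \<not> equivalent_representations (GL scale) scP (\<pi> s) (P s) scP (\<pi> s') (P s')) \<and>
    (\<forall>r\<le>n. orthogonal_sum scale r (min r (n - r)) (V r) \<and>
      (\<forall>s\<le>min r (n - r).
        irreducible_representation_on (GL scale) fscale fun_action (V r s) \<and>
        equivalent_representations (GL scale) fscale fun_action (V r s) scP (\<pi> s) (P s)))"


section \<open>Intertwining maps, their kernels and their normalization\<close>

definition rank_bound :: "nat \<Rightarrow> nat \<Rightarrow> nat \<Rightarrow> nat" where
  "rank_bound n r1 r2 = Min {r1, r2, n - r1, n - r2}"

text \<open>
  On naturals the truncated difference \<open>r2 - r1\<close> is \<open>max 0 (r2 - r1)\<close>.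
\<close>

definition codist_range :: "nat \<Rightarrow> nat \<Rightarrow> nat \<Rightarrow> nat set" where
  "codist_range n r1 r2 = {r2 - r1 .. min r2 (n - r1)}"

definition is_kernel ::
    "('k::field \<Rightarrow> 'v::ab_group_add \<Rightarrow> 'v) \<Rightarrow> nat \<Rightarrow> nat \<Rightarrow> (nat \<Rightarrow> complex) \<Rightarrow>
     (('v set \<Rightarrow> complex) \<Rightarrow> ('v set \<Rightarrow> complex)) \<Rightarrow> bool"
  where "is_kernel scale r1 r2 k \<Lambda> \<longleftrightarrow>
    (\<forall>\<phi>\<in>fun_space scale r1. \<forall>x2\<in>grassmannian scale r2.
      \<Lambda> \<phi> x2 = (\<Sum>x1\<in>grassmannian scale r1. k (codist scale x2 x1) * \<phi> x1))"

text \<open>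
  A nonzero equivariant map from \<open>V\<^sub>r\<^sub>1\<^sub>,\<^sub>s\<close> to \<open>V\<^sub>r\<^sub>2\<^sub>,\<^sub>s\<close>, extended linearly to \<open>V\<^sub>r\<^sub>1\<close> by \<open>0\<close> on the
  orthogonal complement of \<open>V\<^sub>r\<^sub>1\<^sub>,\<^sub>s\<close>.
\<close>

definition component_map ::
    "('k::field \<Rightarrow> 'v::ab_group_add \<Rightarrow> 'v) \<Rightarrow> (nat \<Rightarrow> nat \<Rightarrow> ('v set \<Rightarrow> complex) set) \<Rightarrow>
     nat \<Rightarrow> nat \<Rightarrow> nat \<Rightarrow> (('v set \<Rightarrow> complex) \<Rightarrow> ('v set \<Rightarrow> complex)) \<Rightarrow> bool"
  where "component_map scale V s r1 r2 \<Lambda> \<longleftrightarrow>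
    linear_map_on fscale fscale (fun_space scale r1) \<Lambda> \<and>
    \<Lambda> ` V r1 s \<subseteq> V r2 s \<and>
    equivariant_on (GL scale) fun_action fun_action (V r1 s) \<Lambda> \<and>
    (\<exists>\<phi>\<in>V r1 s. \<Lambda> \<phi> \<noteq> 0) \<and>
    (\<forall>\<phi>\<in>fun_space scale r1. (\<forall>\<psi>\<in>V r1 s. fun_inner scale r1 \<phi> \<psi> = 0) \<longrightarrow> \<Lambda> \<phi> = 0)"

text \<open>
  The polynomial \<open>f\<close> is determined by \<open>k\<close> on \<open>codist_range n r1 r2\<close>, since that set has
  \<open>rank_bound n r1 r2 + 1 > s\<close> elements; \<open>k\<close> is determined there by \<open>\<Lambda>\<close>.
\<close>

definition normalized_component_map ::
    "('k::{field,finite} \<Rightarrow> 'v::ab_group_add \<Rightarrow> 'v) \<Rightarrow> nat \<Rightarrow> (nat \<Rightarrow> nat \<Rightarrow> ('v set \<Rightarrow> complex) set) \<Rightarrow>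
     nat \<Rightarrow> nat \<Rightarrow> nat \<Rightarrow> (('v set \<Rightarrow> complex) \<Rightarrow> ('v set \<Rightarrow> complex)) \<Rightarrow> bool"
  where "normalized_component_map scale n V s r1 r2 \<Lambda> \<longleftrightarrow>
    component_map scale V s r1 r2 \<Lambda> \<and>
    (\<exists>k f. is_kernel scale r1 r2 k \<Lambda> \<and>
       degree f \<le> s \<and>
       (\<forall>t\<in>codist_range n r1 r2. poly f (1 / of_nat CARD('k) ^ t) = k t) \<and>
       poly f 1 = 1)"

end

theory Submission
  imports Defs
begin

text \<open>
  A function of the codistance that is a polynomial of degree at most \<open>s\<close> in \<open>q^(-t)\<close> is a combination
  of the counts of common \<open>j\<close>-dimensional subspaces, \<open>j \<le> s\<close>, hence of the compositions
  \<open>U\<^sub>j D\<^sub>j\<close> of summation maps through \<open>V\<^sub>j\<close>.  The normalized kernels have polynomials of exact degree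
  \<open>s\<close>, because the corresponding maps are linearly independent; so such a polynomial kernel is also a
  combination of the \<open>\<Lambda>\<^sub>i\<close> with \<open>i \<le> s\<close>.  This replaces Schur's lemma throughout.

  Write \<open>E\<close> for \<open>\<Lambda>\<^sub>s\<close> on \<open>V\<^sub>s\<close>, and \<open>D : V\<^sub>a \<rightarrow> V\<^sub>s\<close>, \<open>U : V\<^sub>s \<rightarrow> V\<^sub>b\<close> for the summation maps.  Then \<open>U E D : V\<^sub>a \<rightarrow> V\<^sub>b\<close> is a multiple of \<open>\<Lambda>\<^sub>s\<close>, and the value
  at \<open>1\<close> of its polynomial factors as a function of \<open>b\<close> times a function of \<open>a\<close>.  As \<open>E\<^sup>2\<close> and
  \<open>D U E\<close> are multiples of \<open>E\<close>, the product of two such maps can be computed, and comparing the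
  traces of \<open>U E D\<close> and \<open>D U E\<close> identifies the constant as \<open>card (X b)\<close> divided by a number \<open>\<delta>\<^sub>s\<close>
  that depends on \<open>s\<close> only.  Expanding the identity of \<open>V\<^sub>r\<close> and evaluating at \<open>1\<close> gives
  \<open>(\<Sum>s\<le>r. \<delta>\<^sub>s) = card (X r)\<close>, which determines \<open>\<delta>\<^sub>s\<close>.
\<close>

section \<open>Counting subspaces over a finite field\<close>

locale finite_field_space = finite_dimensional_vector_space scale Basis
  for scale :: "'k::{field,finite} \<Rightarrow> 'v::ab_group_add \<Rightarrow> 'v" (infixr \<open>*s\<close> 75)
    and Basis :: "'v set" +
  fixes q n :: nat
  assumes card_field: "q = CARD('k)"
    and dim_space: "dim (UNIV :: 'v set) = n"
begin

lemma q_gt_1: "1 < q"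
proof -
  have "card {0, 1 :: 'k} \<le> q" unfolding card_field by (intro card_mono) auto
  then show ?thesis by simp
qed

section \<open>Cardinality of finite-dimensional subspaces\<close>

lemma span_insert_image: "span (insert b B) = (\<lambda>(k, y). k *s b + y) ` (UNIV \<times> span B)"
proof (intro equalityI subsetI)
  fix x assume "x \<in> span (insert b B)"
  then obtain k where "x - k *s b \<in> span B" unfolding span_insert by blast
  moreover have "x = k *s b + (x - k *s b)" by simp
  ultimately show "x \<in> (\<lambda>(k, y). k *s b + y) ` (UNIV \<times> span B)" by force
next
  fix x assume "x \<in> (\<lambda>(k, y). k *s b + y) ` (UNIV \<times> span B)"
  then obtain k y where "x = k *s b + y" "y \<in> span B" by auto
  then have "x - k *s b \<in> span B" by simp
  then show "x \<in> span (insert b B)" unfolding span_insert by blast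
qed

lemma card_span_independent:
  assumes "finite B" "independent B"
  shows "finite (span B) \<and> card (span B) = q ^ card B"
  using assms
proof (induction B)
  case empty
  then show ?case by (simp add: span_empty)
next
  case (insert b B)
  have b: "b \<notin> span B" and ind: "independent B"
    using insert.prems insert.hyps by (auto simp: independent_insert)
  have inj: "inj_on (\<lambda>(k, y). k *s b + y) (UNIV \<times> span B)"
  proof (rule inj_onI, clarify)
    fix k k' y y' assume y: "y \<in> span B" "y' \<in> span B" and eq: "k *s b + y = k' *s b + y'"
    have "(k - k') *s b = y' - y" using eq by (simp add: scale_left_diff_distrib algebra_simps)
    then have "(k - k') *s b \<in> span B" using y by (simp add: span_diff)
    then have "k = k'" using b by (metis span_scale scale_scale left_inverse scale_one right_minus_eq)
    then show "k = k' \<and> y = y'" using eq by simp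
  qed
  show ?case
    using insert.IH[OF ind] insert.hyps inj
    by (simp add: span_insert_image card_image card_cartesian_product card_field)
qed

lemma finite_card_subspace:
  assumes "subspace w"
  shows "finite w" "card w = q ^ dim w"
proof -
  obtain B where B: "B \<subseteq> w" "independent B" "w \<subseteq> span B" "card B = dim w"
    using basis_exists by blast
  have "span B = w" using B assms by (simp add: span_minimal subset_antisym)
  then show "finite w" "card w = q ^ dim w"
    using card_span_independent[of B] B by (auto simp: finiteI_independent)
qed

lemma finite_subspaces: "finite (A :: 'v set set)"
proof -
  have "finite (UNIV :: 'v set)" using finite_card_subspace(1)[OF subspace_UNIV] .
  then show ?thesis by (simp add: Finite_Set.finite_set rev_finite_subset[OF _ subset_UNIV])
qed

section \<open>Frames and the number of subspaces between two given ones\<close>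

definition frames :: "nat \<Rightarrow> 'v set \<Rightarrow> 'v set \<Rightarrow> 'v list set" where
  "frames m v w = {xs. length xs = m \<and> set xs \<subseteq> w \<and> dim (v \<union> set xs) = dim v + m}"

lemma dim_Un_set_le: "dim (v \<union> set xs) \<le> dim v + length xs"
  by (induction xs) (auto simp: dim_insert)

lemma frames_0: "frames 0 v w = {[]}"
  by (auto simp: frames_def)

text \<open>The dimension condition says that a frame is independent modulo the span of
  \<open>v\<close>. Each vector raises the dimension by at most one, so the tail of a frame is a
  frame and the head avoids the span of \<open>v\<close> and the tail.\<close>

lemma frames_Suc:
  "frames (Suc m) v w = (\<lambda>(xs, x). x # xs) ` (SIGMA xs:frames m v w. w - span (v \<union> set xs))"
proof (intro equalityI subsetI)
  fix ys assume "ys \<in> frames (Suc m) v w"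
  then obtain x xs where ys: "ys = x # xs" "length xs = m" "x \<in> w" "set xs \<subseteq> w"
      "dim (insert x (v \<union> set xs)) = dim v + Suc m"
    by (auto simp: frames_def length_Suc_conv)
  moreover have "dim (v \<union> set xs) \<le> dim v + m" using dim_Un_set_le[of v xs] ys(2) by simp
  ultimately have "x \<notin> span (v \<union> set xs)" "dim (v \<union> set xs) = dim v + m"
    by (auto simp: dim_insert split: if_splits)
  then show "ys \<in> (\<lambda>(xs, x). x # xs) ` (SIGMA xs:frames m v w. w - span (v \<union> set xs))"
    using ys by (auto simp: frames_def image_iff)
next
  fix ys assume "ys \<in> (\<lambda>(xs, x). x # xs) ` (SIGMA xs:frames m v w. w - span (v \<union> set xs))"
  then show "ys \<in> frames (Suc m) v w" by (auto simp: frames_def dim_insert)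
qed

lemma card_frames:
  assumes w: "subspace w" and vw: "v \<subseteq> w"
  shows "finite (frames m v w) \<and> card (frames m v w) = (\<Prod>i<m. q ^ dim w - q ^ (dim v + i))"
proof (induction m)
  case 0
  then show ?case by (simp add: frames_0)
next
  case (Suc m)
  have "card (w - span (v \<union> set xs)) = q ^ dim w - q ^ (dim v + m)" if "xs \<in> frames m v w" for xs
  proof -
    have "span (v \<union> set xs) \<subseteq> w"
      using that w vw by (intro span_minimal) (auto simp: frames_def)
    moreover have "card (span (v \<union> set xs)) = q ^ (dim v + m)"
      using finite_card_subspace(2)[OF subspace_span, of "v \<union> set xs"] that by (simp add: frames_def)
    ultimately show ?thesis
      using finite_card_subspace(1)[OF subspace_span, of "v \<union> set xs"] finite_card_subspace(2)[OF w]
      by (simp add: card_Diff_subset)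
  qed
  moreover have "inj_on (\<lambda>(xs, x). x # xs) (SIGMA xs:frames m v w. w - span (v \<union> set xs))"
    by (auto simp: inj_on_def)
  ultimately show ?case
    using Suc finite_card_subspace(1)[OF w] by (simp add: frames_Suc card_image)
qed

lemma subspace_dim_eq: "subspace u \<Longrightarrow> subspace w \<Longrightarrow> u \<subseteq> w \<Longrightarrow> dim u = dim w \<Longrightarrow> u = w"
  using subspace_dim_equal by auto

text \<open>Every frame of \<open>w\<close> of length \<open>s - dim v\<close> spans, together with
  \<open>v\<close>, exactly one \<open>u\<close>; this partitions the frames of \<open>w\<close>.
  The quotient is left multiplied out because the counts are natural numbers.\<close>

lemma card_between:
  assumes v: "subspace v" and w: "subspace w" and vw: "v \<subseteq> w" and s: "dim v \<le> s"
  shows "card {u \<in> grassmannian scale s. v \<subseteq> u \<and> u \<subseteq> w} * (\<Prod>i<s - dim v. q ^ s - q ^ (dim v + i))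
    = (\<Prod>i<s - dim v. q ^ dim w - q ^ (dim v + i))" (is "card ?U * ?c = _")
proof -
  let ?m = "s - dim v"
  have un: "frames ?m v w = (\<Union>u\<in>?U. frames ?m v u)"
  proof (intro equalityI subsetI)
    fix xs assume xs: "xs \<in> frames ?m v w"
    have "span (v \<union> set xs) \<subseteq> w"
      using xs w vw by (intro span_minimal) (auto simp: frames_def)
    moreover have "v \<union> set xs \<subseteq> span (v \<union> set xs)" by (rule span_superset)
    ultimately have "span (v \<union> set xs) \<in> ?U"
      using xs s by (simp add: frames_def grassmannian_def)
    moreover have "xs \<in> frames ?m v (span (v \<union> set xs))"
      using xs span_superset[of "v \<union> set xs"] by (simp add: frames_def)
    ultimately show "xs \<in> (\<Union>u\<in>?U. frames ?m v u)" by blast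
  next
    fix xs assume "xs \<in> (\<Union>u\<in>?U. frames ?m v u)"
    then show "xs \<in> frames ?m v w" by (auto simp: frames_def)
  qed
  have span_eq: "span (v \<union> set xs) = u" if "u \<in> ?U" "xs \<in> frames ?m v u" for u xs
    using that s by (intro subspace_dim_eq span_minimal) (auto simp: frames_def grassmannian_def)
  have "card (frames ?m v w) = (\<Sum>u\<in>?U. card (frames ?m v u))"
    unfolding un
  proof (rule card_UN_disjoint)
    show "finite ?U" by (rule finite_subspaces)
    show "\<forall>u\<in>?U. finite (frames ?m v u)" using card_frames by (auto simp: grassmannian_def)
    show "\<forall>u\<in>?U. \<forall>u'\<in>?U. u \<noteq> u' \<longrightarrow> frames ?m v u \<inter> frames ?m v u' = {}"
      using span_eq by blast
  qed
  also have "\<dots> = (\<Sum>u\<in>?U. ?c)"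
    using card_frames[of _ v ?m] by (intro sum.cong) (auto simp: grassmannian_def)
  finally show ?thesis using card_frames[OF w vw, of ?m] by simp
qed

end

section \<open>Matrices and polynomials\<close>

text \<open>Matrices are indexed by the whole type and extended by zero, so that maps between
  different \<open>V_r\<close> share one type and compose without side conditions.\<close>

definition mprod :: "('x \<Rightarrow> 'x \<Rightarrow> complex) \<Rightarrow> ('x \<Rightarrow> 'x \<Rightarrow> complex) \<Rightarrow> 'x \<Rightarrow> 'x \<Rightarrow> complex"
    (infixl \<open>\<odot>\<close> 70)
  where "M \<odot> N = (\<lambda>y x. \<Sum>u\<in>UNIV. M y u * N u x)"

definition mscale :: "complex \<Rightarrow> ('x \<Rightarrow> 'x \<Rightarrow> complex) \<Rightarrow> 'x \<Rightarrow> 'x \<Rightarrow> complex" (infixr \<open>\<cdot>\<close> 75)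
  where "c \<cdot> M = (\<lambda>y x. c * M y x)"

definition mcomb :: "'i set \<Rightarrow> ('i \<Rightarrow> complex) \<Rightarrow> ('i \<Rightarrow> 'x \<Rightarrow> 'x \<Rightarrow> complex) \<Rightarrow> 'x \<Rightarrow> 'x \<Rightarrow> complex"
  where "mcomb I c M = (\<lambda>y x. \<Sum>i\<in>I. c i * M i y x)"

definition mtrace :: "('x \<Rightarrow> 'x \<Rightarrow> complex) \<Rightarrow> complex"
  where "mtrace M = (\<Sum>x\<in>UNIV. M x x)"

lemma mprod_assoc: "(M \<odot> N) \<odot> R = M \<odot> (N \<odot> R)"
  unfolding mprod_def
  by (intro ext, simp add: sum_distrib_left sum_distrib_right mult.assoc, subst sum.swap, rule refl)

lemma mprod_0 [simp]: "0 \<odot> M = 0" "M \<odot> 0 = 0"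
  by (simp_all add: mprod_def fun_eq_iff)

lemma mscale_mprod [simp]: "(c \<cdot> M) \<odot> N = c \<cdot> (M \<odot> N)" "M \<odot> (c \<cdot> N) = c \<cdot> (M \<odot> N)"
  by (auto simp: mprod_def mscale_def fun_eq_iff sum_distrib_left mult_ac)

lemma mscale_0 [simp]: "c \<cdot> 0 = 0" "0 \<cdot> M = 0"
  by (simp_all add: mscale_def fun_eq_iff)

lemma mscale_mscale [simp]: "c \<cdot> d \<cdot> M = (c * d) \<cdot> M"
  by (simp add: mscale_def mult.assoc)

lemma mscale_1 [simp]: "1 \<cdot> M = M"
  by (simp add: mscale_def)

lemma mscale_eq_0_iff: "c \<cdot> M = 0 \<longleftrightarrow> c = 0 \<or> M = 0"
  by (auto simp: mscale_def fun_eq_iff)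

lemma mscale_cancel: "c \<cdot> M = d \<cdot> M \<Longrightarrow> M \<noteq> 0 \<Longrightarrow> c = d"
  by (auto simp: mscale_def fun_eq_iff)

lemma mscale_left_imp_eq: "c \<cdot> M = c \<cdot> N \<Longrightarrow> c \<noteq> 0 \<Longrightarrow> M = N"
  by (simp add: mscale_def fun_eq_iff)

lemma mcomb_mprod: "mcomb I c M \<odot> N = mcomb I c (\<lambda>i. M i \<odot> N)"
  unfolding mprod_def mcomb_def
  by (intro ext, simp add: sum_distrib_left sum_distrib_right mult.assoc, rule sum.swap)

lemma mprod_mcomb: "N \<odot> mcomb I c M = mcomb I c (\<lambda>i. N \<odot> M i)"
  unfolding mprod_def mcomb_def
  by (intro ext, simp add: sum_distrib_left sum_distrib_right mult_ac, rule sum.swap)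

lemma mcomb_single:
  assumes "finite I" "m \<in> I" "\<And>i. i \<in> I \<Longrightarrow> i \<noteq> m \<Longrightarrow> M i = 0"
  shows "mcomb I c M = c m \<cdot> M m"
proof (intro ext)
  fix y x
  have "(\<Sum>i\<in>I. c i * M i y x) = (\<Sum>i\<in>{m}. c i * M i y x)"
    using assms by (intro sum.mono_neutral_right) auto
  then show "mcomb I c M y x = (c m \<cdot> M m) y x" by (simp add: mcomb_def mscale_def)
qed

lemma mcomb_0: "(\<And>i. i \<in> I \<Longrightarrow> M i = 0) \<Longrightarrow> mcomb I c M = 0"
  by (simp add: mcomb_def fun_eq_iff)

lemma mtrace_mscale [simp]: "mtrace (c \<cdot> M) = c * mtrace M"
  by (simp add: mtrace_def mscale_def sum_distrib_left)

lemma mtrace_mprod_commute: "mtrace (M \<odot> N) = mtrace (N \<odot> M)"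
  unfolding mtrace_def mprod_def by (subst sum.swap) (simp add: mult.commute)

section \<open>Triangular bases of polynomials and interpolation\<close>

lemma poly_triangular:
  fixes B :: "nat \<Rightarrow> complex poly"
  assumes "\<And>j. j \<le> m \<Longrightarrow> degree (B j) = j" "\<And>j. j \<le> m \<Longrightarrow> B j \<noteq> 0" "degree p \<le> m"
  shows "\<exists>c. p = (\<Sum>j\<le>m. smult (c j) (B j))"
  using assms
proof (induction m arbitrary: p)
  case 0
  obtain a b where "p = [:a:]" "B 0 = [:b:]" "b \<noteq> 0"
    using 0 by (metis degree_eq_zeroE le_zero_eq pCons_0_0 le_refl)
  then show ?case by (intro exI[of _ "\<lambda>_. a / b"]) simp
next
  case (Suc m)
  \<comment> \<open>Subtracting this multiple of \<open>B (Suc m)\<close> cancels the top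
    coefficient.\<close>
  define a where "a = coeff p (Suc m) / coeff (B (Suc m)) (Suc m)"
  have "coeff (B (Suc m)) (Suc m) \<noteq> 0"
    using Suc.prems(1,2)[of "Suc m"] leading_coeff_neq_0[of "B (Suc m)"] by simp
  then have "coeff (p - smult a (B (Suc m))) (Suc m) = 0" by (simp add: a_def)
  moreover have "degree (p - smult a (B (Suc m))) \<le> Suc m"
    using Suc.prems(1)[of "Suc m"] Suc.prems(3) by (intro degree_diff_le) auto
  ultimately have "degree (p - smult a (B (Suc m))) \<le> m"
    by (metis degree_0 eq_zero_or_degree_less le_SucE less_Suc_eq_le zero_le)
  then obtain c where "p - smult a (B (Suc m)) = (\<Sum>j\<le>m. smult (c j) (B j))"
    using Suc.IH[of "p - smult a (B (Suc m))"] Suc.prems(1,2) by auto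
  then have "p = (\<Sum>j\<le>m. smult (c j) (B j)) + smult a (B (Suc m))" by (simp add: diff_eq_eq)
  then show ?case by (intro exI[of _ "c(Suc m := a)"]) simp
qed

lemma poly_interpolation:
  fixes z F :: "nat \<Rightarrow> complex"
  assumes "inj_on z {..m}"
  shows "\<exists>p. degree p \<le> m \<and> (\<forall>i\<le>m. poly p (z i) = F i)"
  using assms
proof (induction m)
  case 0
  then show ?case by (intro exI[of _ "[:F 0:]"]) simp
next
  case (Suc m)
  then obtain p where p: "degree p \<le> m" "\<forall>i\<le>m. poly p (z i) = F i"
    by (auto simp: inj_on_def)
  \<comment> \<open>Newton's scheme: \<open>w\<close> vanishes at the old nodes, so adding a
    multiple of it keeps the values already prescribed.\<close>
  define w where "w = (\<Prod>i\<le>m. [:- z i, 1:])"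
  have w0: "poly w (z i) = 0" if "i \<le> m" for i
    using that by (auto simp: w_def poly_prod intro!: prod_zero)
  have w1: "poly w (z (Suc m)) \<noteq> 0"
    using inj_onD[OF Suc.prems, of "Suc m"] by (force simp: w_def poly_prod)
  have dw: "degree w = Suc m"
    unfolding w_def by (subst degree_prod_eq_sum_degree) auto
  define c where "c = (F (Suc m) - poly p (z (Suc m))) / poly w (z (Suc m))"
  have "degree (p + smult c w) \<le> Suc m"
    using p(1) dw by (intro degree_add_le) auto
  moreover have "poly (p + smult c w) (z i) = F i" if "i \<le> Suc m" for i
    using that p(2) w0 w1 by (auto simp: le_Suc_eq c_def)
  ultimately show ?case by blast
qed

section \<open>Polynomial kernels\<close>

context finite_field_space
begin

abbreviation Q :: complex where "Q \<equiv> of_nat q"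
abbreviation X where "X r \<equiv> grassmannian scale r"

section \<open>Complex-valued counts\<close>

lemma Q_power_eq_iff: "Q ^ i = Q ^ j \<longleftrightarrow> i = j"
  using q_gt_1 by (simp flip: of_nat_power)

lemma q_nonzero [simp]: "q \<noteq> 0"
  using q_gt_1 by simp

text \<open>The subtraction on naturals truncates only beyond \<open>i = b - j\<close>; as soon as
  such a factor occurs, the factor at \<open>i = b - j\<close> is zero on both sides.\<close>

lemma of_nat_prod_diff:
  assumes "j \<le> b"
  shows "of_nat (\<Prod>i<m. q ^ b - q ^ (j + i)) = (\<Prod>i<m. Q ^ b - Q ^ (j + i))"
proof (cases "m \<le> Suc (b - j)")
  case True
  have "of_nat (q ^ b - q ^ (j + i)) = Q ^ b - Q ^ (j + i)" if "i < m" for i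
    using that True assms q_gt_1 by (subst of_nat_diff) (auto intro: power_increasing)
  then show ?thesis by (simp only: of_nat_prod) (rule prod.cong, auto)
next
  case False
  then have "b - j \<in> {..<m}" by simp
  moreover have "q ^ b - q ^ (j + (b - j)) = 0" "Q ^ b - Q ^ (j + (b - j)) = 0" using assms by simp_all
  ultimately have "(\<Prod>i<m. q ^ b - q ^ (j + i)) = 0" "(\<Prod>i<m. Q ^ b - Q ^ (j + i)) = 0"
    by (meson finite_lessThan prod_zero)+
  then show ?thesis by (simp only: of_nat_0)
qed

text \<open>The Gaussian binomial of \<open>b - j\<close> over \<open>s - j\<close>, for
  \<open>j \<le> s\<close> and \<open>j \<le> b\<close>, in a form that is visibly a polynomial in
  \<open>Q ^ b\<close>.\<close>

definition between :: "nat \<Rightarrow> nat \<Rightarrow> nat \<Rightarrow> complex" where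
  "between j s b = (\<Prod>i<s - j. Q ^ b - Q ^ (j + i)) / (\<Prod>i<s - j. Q ^ s - Q ^ (j + i))"

lemma card_between_eq:
  assumes "subspace v" "subspace w" "v \<subseteq> w" "dim v \<le> s"
  shows "of_nat (card {u \<in> X s. v \<subseteq> u \<and> u \<subseteq> w}) = between (dim v) s (dim w)"
proof -
  have "(\<Prod>i<s - dim v. Q ^ s - Q ^ (dim v + i)) \<noteq> 0"
    by (auto simp: Q_power_eq_iff)
  moreover have "of_nat (card {u \<in> X s. v \<subseteq> u \<and> u \<subseteq> w}) * (\<Prod>i<s - dim v. Q ^ s - Q ^ (dim v + i))
      = (\<Prod>i<s - dim v. Q ^ dim w - Q ^ (dim v + i))"
    using arg_cong[OF card_between[OF assms], of "of_nat :: nat \<Rightarrow> complex"]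
      of_nat_prod_diff[OF dim_subset[OF assms(3)]] of_nat_prod_diff[OF assms(4)]
    by (simp only: of_nat_mult)
  ultimately show ?thesis by (simp add: between_def field_simps)
qed

definition subspace_poly :: "nat \<Rightarrow> complex poly" where
  "subspace_poly j = smult (inverse (\<Prod>i<j. Q ^ j - Q ^ i)) (\<Prod>i<j. [:- (Q ^ i), 1:])"

lemma poly_subspace_poly: "poly (subspace_poly s) (Q ^ b) = between 0 s b"
  by (simp add: subspace_poly_def between_def poly_prod field_simps)

lemma degree_subspace_poly: "degree (subspace_poly j) = j" "subspace_poly j \<noteq> 0"
  by (auto simp: subspace_poly_def degree_prod_eq_sum_degree Q_power_eq_iff)

lemma card_subspaces_of:
  assumes "subspace w"
  shows "of_nat (card {u \<in> X s. u \<subseteq> w}) = between 0 s (dim w)"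
proof -
  have "{u \<in> X s. {0} \<subseteq> u \<and> u \<subseteq> w} = {u \<in> X s. u \<subseteq> w}"
    by (auto simp: grassmannian_def subspace_0)
  moreover have "dim {0} = 0" using dim_span[of "{}"] by (simp add: span_empty)
  ultimately show ?thesis
    using card_between_eq[of "{0}" w s] assms by (simp add: subspace_0 subspace_single_0)
qed

lemma exists_subspace: "b \<le> n \<Longrightarrow> \<exists>w. w \<in> X b"
proof -
  assume "b \<le> n"
  then have "between 0 b n \<noteq> 0" by (auto simp: between_def Q_power_eq_iff)
  then show ?thesis
    using card_subspaces_of[OF subspace_UNIV, of b] by (cases "X b = {}") (auto simp: dim_space simp del: dim_UNIV)
qed

text \<open>Both sides count the pairs of a \<open>j\<close>-dimensional \<open>v\<close> inside an
  \<open>s\<close>-dimensional \<open>u\<close> inside a fixed \<open>w\<close> of dimension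
  \<open>b\<close>: on the left \<open>v\<close> is chosen first, on the right
  \<open>u\<close>.\<close>

lemma between_flags:
  assumes "j \<le> s" "b \<le> n"
  shows "between j s b * between 0 j b = between 0 s b * between 0 j s"
proof -
  obtain w where w: "subspace w" "dim w = b"
    using exists_subspace[OF assms(2)] by (auto simp: grassmannian_def)
  have "between j s b * between 0 j b = (\<Sum>v\<in>{v \<in> X j. v \<subseteq> w}. of_nat (card {u \<in> X s. v \<subseteq> u \<and> u \<subseteq> w}))"
    using card_subspaces_of[OF w(1), of j] card_between_eq[OF _ w(1), of _ s] assms w(2)
    by (simp add: grassmannian_def)
  also have "\<dots> = (\<Sum>v\<in>{v \<in> X j. v \<subseteq> w}. \<Sum>u\<in>{u \<in> {u \<in> X s. u \<subseteq> w}. v \<subseteq> u}. 1)"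
    by (simp add: conj_ac)
  also have "\<dots> = (\<Sum>u\<in>{u \<in> X s. u \<subseteq> w}. \<Sum>v\<in>{v \<in> {v \<in> X j. v \<subseteq> w}. v \<subseteq> u}. 1)"
    by (rule sum.swap_restrict) (rule finite_subspaces)+
  also have "\<dots> = (\<Sum>u\<in>{u \<in> X s. u \<subseteq> w}. between 0 j s)"
  proof (rule sum.cong[OF refl])
    fix u assume u: "u \<in> {u \<in> X s. u \<subseteq> w}"
    then have "{v \<in> {v \<in> X j. v \<subseteq> w}. v \<subseteq> u} = {v \<in> X j. v \<subseteq> u}" by auto
    then show "(\<Sum>v\<in>{v \<in> {v \<in> X j. v \<subseteq> w}. v \<subseteq> u}. 1) = between 0 j s"
      using card_subspaces_of[of u j] u by (simp add: grassmannian_def)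
  qed
  also have "\<dots> = between 0 s b * between 0 j s"
    using card_subspaces_of[OF w(1), of s] w(2) by simp
  finally show ?thesis .
qed

text \<open>Rows \<open>y\<close> belong to the target \<open>X b\<close>, columns \<open>x\<close>
  to the source \<open>X a\<close>. The argument of \<open>p\<close> is \<open>q^(-t)\<close> for
  the codistance \<open>t = b - dim (y \<inter> x)\<close>.\<close>

definition poly_kernel :: "nat \<Rightarrow> nat \<Rightarrow> complex poly \<Rightarrow> 'v set \<Rightarrow> 'v set \<Rightarrow> complex" where
  "poly_kernel a b p y x = (if y \<in> X b \<and> x \<in> X a then poly p (Q ^ dim (y \<inter> x) / Q ^ b) else 0)"

text \<open>The matrix of the summation map \<open>U\<close> from functions on \<open>X j\<close> to
  functions on \<open>X b\<close>; \<open>rest\<close> is its transpose, the map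
  \<open>D\<close>.\<close>

definition incl :: "nat \<Rightarrow> nat \<Rightarrow> 'v set \<Rightarrow> 'v set \<Rightarrow> complex" where
  "incl j b y u = of_bool (y \<in> X b \<and> u \<in> X j \<and> u \<subseteq> y)"

definition rest :: "nat \<Rightarrow> nat \<Rightarrow> 'v set \<Rightarrow> 'v set \<Rightarrow> complex" where
  "rest a j u x = incl j a x u"

definition scaled_poly :: "nat \<Rightarrow> nat \<Rightarrow> complex poly" where
  "scaled_poly j b = pcompose (subspace_poly j) [:0, Q ^ b:]"

lemma degree_scaled_poly: "degree (scaled_poly j b) = j" "scaled_poly j b \<noteq> 0"
  using degree_subspace_poly[of j] pcompose_eq_0[of "subspace_poly j" "[:0, Q ^ b:]"]
  by (auto simp: scaled_poly_def degree_pcompose)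

lemma poly_scaled_poly: "poly (scaled_poly j b) (Q ^ d / Q ^ b) = between 0 j d"
  by (simp add: scaled_poly_def poly_pcompose poly_subspace_poly)

lemma poly_scaled_poly_1: "poly (scaled_poly j b) 1 = between 0 j b"
  by (simp add: scaled_poly_def poly_pcompose poly_subspace_poly)

section \<open>Expansion of polynomial kernels in products of summation maps\<close>

lemma poly_kernel_sum_smult:
  "poly_kernel a b (\<Sum>i\<in>I. smult (c i) (p i)) = mcomb I c (\<lambda>i. poly_kernel a b (p i))"
  by (auto simp: poly_kernel_def mcomb_def fun_eq_iff poly_sum)

lemma sum_of_bool: "(\<Sum>u\<in>(UNIV :: 'v set set). of_bool (P u)) = (of_nat (card {u. P u}) :: complex)"
  using finite_subspaces[of UNIV] by (simp add: sum_of_bool_eq)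

lemma mprod_of_bool:
  "((\<lambda>y u. of_bool (A y u)) \<odot> (\<lambda>u x. of_bool (B u x))) y (x :: 'v set) = of_nat (card {u. A y u \<and> B u x})"
  unfolding mprod_def of_bool_conj[symmetric] by (rule sum_of_bool)

lemma mtrace_poly_kernel: "mtrace (poly_kernel r r p) = of_nat (card (X r)) * poly p 1"
proof -
  have "mtrace (poly_kernel r r p) = (\<Sum>x\<in>UNIV. of_bool (x \<in> X r) * poly p 1)"
    unfolding mtrace_def by (intro sum.cong) (auto simp: poly_kernel_def grassmannian_def)
  then show ?thesis by (simp only: sum_of_bool flip: sum_distrib_right) simp
qed

lemma subspace_Int_X: "y \<in> X b \<Longrightarrow> x \<in> X a \<Longrightarrow> subspace (y \<inter> x)"
  by (auto simp: grassmannian_def intro: subspace_inter)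

text \<open>The \<open>j\<close>-dimensional subspaces common to \<open>y\<close> and
  \<open>x\<close> are those of \<open>y \<inter> x\<close>, and their number is a polynomial of
  degree \<open>j\<close> in \<open>Q ^ dim (y \<inter> x)\<close>.\<close>

lemma incl_rest: "incl j b \<odot> rest a j = poly_kernel a b (scaled_poly j b)"
proof (intro ext)
  fix y x
  have "(incl j b \<odot> rest a j) y x
      = of_nat (card {u. (y \<in> X b \<and> u \<in> X j \<and> u \<subseteq> y) \<and> x \<in> X a \<and> u \<in> X j \<and> u \<subseteq> x})"
    unfolding incl_def rest_def by (rule mprod_of_bool)
  also have "{u. (y \<in> X b \<and> u \<in> X j \<and> u \<subseteq> y) \<and> x \<in> X a \<and> u \<in> X j \<and> u \<subseteq> x}
      = (if y \<in> X b \<and> x \<in> X a then {u \<in> X j. u \<subseteq> y \<inter> x} else {})" by auto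
  also have "of_nat (card \<dots>) = poly_kernel a b (scaled_poly j b) y x"
    using card_subspaces_of[OF subspace_Int_X, of y b x a j]
    by (simp add: poly_kernel_def poly_scaled_poly)
  finally show "(incl j b \<odot> rest a j) y x = poly_kernel a b (scaled_poly j b) y x" .
qed

lemma between_eq_0: "j > d \<Longrightarrow> between 0 j d = 0"
  by (auto simp: between_def)

lemma between_self: "between 0 j j = 1"
  by (auto simp: between_def Q_power_eq_iff)

lemma dim_Int_X:
  assumes "y \<in> X b" "u \<in> X s"
  shows "dim (y \<inter> u) \<le> s" "dim (y \<inter> u) = s \<longleftrightarrow> u \<subseteq> y"
proof -
  show "dim (y \<inter> u) \<le> s" using assms dim_subset[of "y \<inter> u" u] by (simp add: grassmannian_def)
  show "dim (y \<inter> u) = s \<longleftrightarrow> u \<subseteq> y"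
  proof
    assume "dim (y \<inter> u) = s"
    then have "y \<inter> u = u"
      using assms by (intro subspace_dim_eq subspace_Int_X) (auto simp: grassmannian_def)
    then show "u \<subseteq> y" by blast
  next
    assume "u \<subseteq> y"
    then have "y \<inter> u = u" by blast
    then show "dim (y \<inter> u) = s" using assms by (simp add: grassmannian_def)
  qed
qed

text \<open>For \<open>u\<close> of dimension \<open>s\<close>, the number of
  \<open>s\<close>-dimensional subspaces of \<open>u \<inter> x\<close> is one or zero according to
  whether \<open>x\<close> contains \<open>u\<close>. So expansions of polynomial kernels also apply
  to \<open>D\<close>.\<close>

lemma rest_eq_poly_kernel: "rest a s = poly_kernel a s (scaled_poly s s)"
proof (intro ext)
  fix u x
  show "rest a s u x = poly_kernel a s (scaled_poly s s) u x"
    using dim_Int_X[of x a u s]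
    by (auto simp: rest_def incl_def poly_kernel_def poly_scaled_poly between_self between_eq_0 le_less
        Int_commute)
qed

lemma poly_kernel_decomp:
  assumes "degree p \<le> m"
  shows "\<exists>c. p = (\<Sum>j\<le>m. smult (c j) (scaled_poly j b)) \<and>
    poly_kernel a b p = mcomb {..m} c (\<lambda>j. incl j b \<odot> rest a j)"
proof -
  obtain c where "p = (\<Sum>j\<le>m. smult (c j) (scaled_poly j b))"
    using poly_triangular[of m "\<lambda>j. scaled_poly j b" p] degree_scaled_poly assms by auto
  moreover from this have "poly_kernel a b p = mcomb {..m} c (\<lambda>j. incl j b \<odot> rest a j)"
    by (simp only: poly_kernel_sum_smult incl_rest)
  ultimately show ?thesis by blast
qed

section \<open>Composition of summation maps\<close>

lemma incl_incl:
  assumes "j \<le> s"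
  shows "incl s b \<odot> incl j s = between j s b \<cdot> incl j b"
proof (intro ext)
  fix y v
  have "(incl s b \<odot> incl j s) y v
      = of_nat (card {u. (y \<in> X b \<and> u \<in> X s \<and> u \<subseteq> y) \<and> u \<in> X s \<and> v \<in> X j \<and> v \<subseteq> u})"
    unfolding incl_def by (rule mprod_of_bool)
  also have "{u. (y \<in> X b \<and> u \<in> X s \<and> u \<subseteq> y) \<and> u \<in> X s \<and> v \<in> X j \<and> v \<subseteq> u}
      = (if y \<in> X b \<and> v \<in> X j \<and> v \<subseteq> y then {u \<in> X s. v \<subseteq> u \<and> u \<subseteq> y} else {})" by auto
  also have "of_nat (card \<dots>) = (between j s b \<cdot> incl j b) y v"
    using card_between_eq[of v y s] assms by (simp add: mscale_def incl_def grassmannian_def)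
  finally show "(incl s b \<odot> incl j s) y v = (between j s b \<cdot> incl j b) y v" .
qed

lemma rest_rest:
  assumes "j \<le> s"
  shows "rest s j \<odot> rest a s = between j s a \<cdot> rest a j"
proof (intro ext)
  fix v x
  have "(rest s j \<odot> rest a s) v x = (incl s a \<odot> incl j s) x v"
    by (simp add: mprod_def rest_def mult.commute)
  then show "(rest s j \<odot> rest a s) v x = (between j s a \<cdot> rest a j) v x"
    by (simp add: incl_incl[OF assms] mscale_def rest_def)
qed

text \<open>Expanding the kernel on \<open>V_s\<close> in products \<open>U_j D_j\<close> and
  collapsing compositions gives terms whose value at \<open>1\<close> contains
  \<open>between j s b * between 0 j b\<close>. By \<open>between_flags\<close> this is
  \<open>between 0 s b * between 0 j s\<close>, so \<open>b\<close> enters only through a common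
  factor; the quantifiers record that \<open>h\<close> is independent of \<open>b\<close>.\<close>

lemma incl_poly_kernel_rest:
  assumes "degree p \<le> s"
  shows "\<exists>h. \<forall>a b. b \<le> n \<longrightarrow> (\<exists>g. degree g \<le> s \<and> poly g 1 = between 0 s b * h a \<and>
    incl s b \<odot> poly_kernel s s p \<odot> rest a s = poly_kernel a b g)"
proof -
  obtain e where e: "poly_kernel s s p = mcomb {..s} e (\<lambda>j. incl j s \<odot> rest s j)"
    using poly_kernel_decomp[OF assms] by blast
  define h where "h a = (\<Sum>j\<le>s. e j * between j s a * between 0 j s)" for a
  define g where "g a b = (\<Sum>j\<le>s. smult (e j * between j s b * between j s a) (scaled_poly j b))" for a b
  have "degree (g a b) \<le> s" for a b
    unfolding g_def by (intro degree_sum_le) (auto simp: degree_scaled_poly intro: order.trans[OF degree_smult_le])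
  moreover have "poly (g a b) 1 = between 0 s b * h a" if "b \<le> n" for a b
    unfolding g_def h_def sum_distrib_left poly_sum poly_smult poly_scaled_poly_1
    using between_flags[OF _ that] by (intro sum.cong) (simp_all add: mult_ac)
  moreover have "incl s b \<odot> poly_kernel s s p \<odot> rest a s = poly_kernel a b (g a b)" for a b
  proof -
    have "incl s b \<odot> (incl j s \<odot> rest s j) \<odot> rest a s
        = (between j s b * between j s a) \<cdot> (incl j b \<odot> rest a j)" if "j \<le> s" for j
    proof -
      have "incl s b \<odot> (incl j s \<odot> rest s j) \<odot> rest a s = (incl s b \<odot> incl j s) \<odot> (rest s j \<odot> rest a s)"
        by (simp only: mprod_assoc)
      then show ?thesis by (simp add: incl_incl[OF that] rest_rest[OF that] mult.commute)
    qed
    then have "e j * (incl s b \<odot> (incl j s \<odot> rest s j) \<odot> rest a s) y x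
        = e j * between j s b * between j s a * (incl j b \<odot> rest a j) y x" if "j \<le> s" for j y x
      using that by (simp add: mscale_def)
    then show ?thesis
      unfolding e g_def mprod_mcomb mcomb_mprod poly_kernel_sum_smult incl_rest[symmetric]
      unfolding mcomb_def by (intro ext sum.cong refl) (simp only: atMost_iff mult.assoc)
  qed
  ultimately show ?thesis by blast
qed

text \<open>On \<open>X s\<close> the intersection dimension takes at most \<open>s + 1\<close>
  values, so every function of it can be interpolated in degree \<open>s\<close>.\<close>

lemma poly_kernel_interpolation:
  "\<exists>p. degree p \<le> s \<and>
    poly_kernel s s p = (\<lambda>y x. if y \<in> X s \<and> x \<in> X s then F (dim (y \<inter> x)) else 0)"
proof -
  have "inj_on (\<lambda>d. Q ^ d / Q ^ s) {..s}" by (simp add: inj_on_def Q_power_eq_iff)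
  then obtain p where "degree p \<le> s" "\<forall>d\<le>s. poly p (Q ^ d / Q ^ s) = F d"
    using poly_interpolation by blast
  then show ?thesis using dim_Int_X(1) by (intro exI[of _ p]) (auto simp: poly_kernel_def fun_eq_iff)
qed

section \<open>The identity and the product \<open>D U\<close> as polynomial kernels\<close>

definition idmat :: "nat \<Rightarrow> 'v set \<Rightarrow> 'v set \<Rightarrow> complex" where
  "idmat r y x = of_bool (y = x \<and> x \<in> X r)"

lemma sum_single: "(\<Sum>u\<in>(UNIV :: 'v set set). if u = y then F u else 0) = (F y :: complex)"
  using finite_subspaces[of UNIV] by simp

lemma idmat_mprod: "(\<And>y x. y \<notin> X b \<Longrightarrow> M y x = 0) \<Longrightarrow> idmat b \<odot> M = M"
  and mprod_idmat: "(\<And>y x. x \<notin> X a \<Longrightarrow> M y x = 0) \<Longrightarrow> M \<odot> idmat a = M"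
proof -
  assume M: "\<And>y x. y \<notin> X b \<Longrightarrow> M y x = 0"
  have "(\<Sum>u\<in>UNIV. idmat b y u * M u x) = (\<Sum>u\<in>UNIV. if u = y then M u x else 0)" for y x
    using M by (intro sum.cong) (auto simp: idmat_def)
  then show "idmat b \<odot> M = M" by (simp only: mprod_def sum_single)
next
  assume M: "\<And>y x. x \<notin> X a \<Longrightarrow> M y x = 0"
  have "(\<Sum>u\<in>UNIV. M y u * idmat a u x) = (\<Sum>u\<in>UNIV. if u = x then M y u else 0)" for y x
    using M by (intro sum.cong) (auto simp: idmat_def)
  then show "M \<odot> idmat a = M" by (simp only: mprod_def sum_single)
qed

lemma idmat_poly_kernel: "idmat b \<odot> poly_kernel a b p = poly_kernel a b p"
  by (rule idmat_mprod) (simp add: poly_kernel_def)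

lemma poly_kernel_idmat: "poly_kernel a b p \<odot> idmat a = poly_kernel a b p"
  by (rule mprod_idmat) (simp add: poly_kernel_def)

text \<open>Two elements of \<open>X s\<close> coincide iff their intersection has dimension
  \<open>s\<close>, so interpolation applies. The value at \<open>1\<close> is read off a diagonal
  entry, which exists by \<open>s \<le> n\<close>.\<close>

lemma idmat_eq_poly_kernel:
  assumes "s \<le> n"
  shows "\<exists>p. degree p \<le> s \<and> poly p 1 = 1 \<and> idmat s = poly_kernel s s p"
proof -
  obtain p where p: "degree p \<le> s" and
    eq: "poly_kernel s s p = (\<lambda>y x. if y \<in> X s \<and> x \<in> X s then of_bool (dim (y \<inter> x) = s) else 0)"
    using poly_kernel_interpolation[of s "\<lambda>d. of_bool (d = s)"] by blast
  have "poly_kernel s s p y x = idmat s y x" for y x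
  proof (cases "y \<in> X s \<and> x \<in> X s")
    case True
    then have "dim (y \<inter> x) = s \<longleftrightarrow> y = x"
      using dim_Int_X(2)[of y s x s] subspace_dim_eq[of x y] by (auto simp: grassmannian_def)
    with True show ?thesis by (simp add: eq idmat_def)
  qed (auto simp: eq idmat_def)
  then have "idmat s = poly_kernel s s p" by (intro ext) simp
  moreover from this have "poly p 1 = 1"
  proof -
    obtain w where "w \<in> X s" using exists_subspace assms by blast
    then show ?thesis using fun_cong[OF fun_cong[OF calculation, of w], of w]
      by (simp add: idmat_def poly_kernel_def grassmannian_def)
  qed
  ultimately show ?thesis using p by blast
qed

text \<open>An entry counts the \<open>b\<close>-dimensional subspaces containing
  \<open>u + u'\<close>, whose dimension is \<open>2 * s - dim (u \<inter> u')\<close>; hence it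
  depends on the intersection dimension only.\<close>

lemma rest_incl:
  "\<exists>p. degree p \<le> s \<and> rest b s \<odot> incl s b = poly_kernel s s p"
proof -
  \<comment> \<open>The value \<open>0\<close> covers sums \<open>u + u'\<close> too large to lie in
    a subspace of dimension \<open>b\<close>.\<close>
  define F where "F d = (if 2 * s - d \<le> b then between (2 * s - d) b n else 0)" for d
  have "(rest b s \<odot> incl s b) u u' = (if u \<in> X s \<and> u' \<in> X s then F (dim (u \<inter> u')) else 0)" for u u'
  proof -
    have "(rest b s \<odot> incl s b) u u'
        = of_nat (card {y. (y \<in> X b \<and> u \<in> X s \<and> u \<subseteq> y) \<and> y \<in> X b \<and> u' \<in> X s \<and> u' \<subseteq> y})"
      unfolding incl_def rest_def by (rule mprod_of_bool)
    also have "\<dots> = (if u \<in> X s \<and> u' \<in> X s then F (dim (u \<inter> u')) else 0)"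
    proof (cases "u \<in> X s \<and> u' \<in> X s")
      case True
      then have sub: "subspace u" "subspace u'" and d: "dim u = s" "dim u' = s"
        by (auto simp: grassmannian_def)
      define w where "w = {x + y |x y. x \<in> u \<and> y \<in> u'}"
      have w: "subspace w" "dim w + dim (u \<inter> u') = 2 * s"
        using subspace_sums[OF sub] dim_sums_Int[OF sub] d by (auto simp: w_def)
      have uw: "u \<subseteq> w" "u' \<subseteq> w" unfolding w_def
        using subspace_0[OF sub(1)] subspace_0[OF sub(2)] by force+
      have "u \<subseteq> y \<and> u' \<subseteq> y \<longleftrightarrow> w \<subseteq> y" if "y \<in> X b" for y
        using that uw by (auto simp: w_def grassmannian_def intro!: subspace_add)
      then have "{y. (y \<in> X b \<and> u \<in> X s \<and> u \<subseteq> y) \<and> y \<in> X b \<and> u' \<in> X s \<and> u' \<subseteq> y}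
          = {y \<in> X b. w \<subseteq> y \<and> y \<subseteq> UNIV}" using True by auto
      moreover have "of_nat (card {y \<in> X b. w \<subseteq> y \<and> y \<subseteq> UNIV}) = F (dim (u \<inter> u'))"
      proof (cases "dim w \<le> b")
        case True
        then show ?thesis using card_between_eq[OF w(1) subspace_UNIV subset_UNIV True] w(2)
          by (simp add: F_def dim_space flip: w(2) del: dim_UNIV)
      next
        case False
        then have "{y \<in> X b. w \<subseteq> y \<and> y \<subseteq> UNIV} = {}"
          using dim_subset by (force simp: grassmannian_def)
        then have "card {y \<in> X b. w \<subseteq> y \<and> y \<subseteq> UNIV} = 0" by (simp only: card.empty)
        then show ?thesis using False by (simp only: of_nat_0 F_def flip: w(2)) simp
      qed
      ultimately show ?thesis using True by simp
    qed auto
    finally show ?thesis .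
  qed
  then have "rest b s \<odot> incl s b
      = (\<lambda>u u'. if u \<in> X s \<and> u' \<in> X s then F (dim (u \<inter> u')) else 0)" by blast
  then show ?thesis using poly_kernel_interpolation[of s F] by metis
qed

end

section \<open>Kernels of the component maps\<close>

text \<open>This is \<open>r \<le> n\<close> and \<open>s \<le> min r (n - r)\<close>, the condition
  that \<open>\<pi> s\<close> is a constituent of \<open>V_r\<close>, free of truncated
  subtraction.\<close>

definition (in finite_field_space) occurs :: "nat \<Rightarrow> nat \<Rightarrow> bool" where
  "occurs s r \<longleftrightarrow> s \<le> r \<and> s + r \<le> n"

text \<open>The decomposition in terms of matrices: maps of distinct components compose to zero, and
  \<open>\<Phi>\<close> stands for a vector of \<open>V a m\<close> that the map of component
  \<open>m\<close> does not kill.\<close>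

locale component_kernels = finite_field_space +
  fixes f :: "nat \<Rightarrow> nat \<Rightarrow> nat \<Rightarrow> complex poly"
  assumes degree_f: "\<lbrakk>occurs s a; occurs s b\<rbrakk> \<Longrightarrow> degree (f s a b) \<le> s"
    and f_1: "\<lbrakk>occurs s a; occurs s b\<rbrakk> \<Longrightarrow> poly (f s a b) 1 = 1"
    and orthogonal: "\<lbrakk>occurs i b; occurs i d; occurs j a; occurs j b; i \<noteq> j\<rbrakk>
      \<Longrightarrow> poly_kernel b d (f i b d) \<odot> poly_kernel a b (f j a b) = 0"
    and separated: "\<lbrakk>occurs m a; occurs m b\<rbrakk> \<Longrightarrow> \<exists>\<Phi>. poly_kernel a b (f m a b) \<odot> \<Phi> \<noteq> 0 \<and>
      (\<forall>i b'. occurs i a \<longrightarrow> occurs i b' \<longrightarrow> i \<noteq> m \<longrightarrow> poly_kernel a b' (f i a b') \<odot> \<Phi> = 0)"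
begin

definition L where "L s a b = poly_kernel a b (f s a b)"

section \<open>Exact degrees and expansions in the matrices \<open>L\<close>\<close>

lemma L_nonzero: "occurs s a \<Longrightarrow> occurs s b \<Longrightarrow> L s a b \<noteq> 0"
  using separated[of s a b] by (auto simp: L_def)

lemma occurs_le: "occurs m a \<Longrightarrow> i \<le> m \<Longrightarrow> occurs i a"
  by (auto simp: occurs_def)

text \<open>A smaller degree would make \<open>f m a b\<close> a combination of the
  \<open>f j a b\<close> with \<open>j < m\<close>, whose degrees are exact by induction. The
  \<open>\<Phi>\<close> from \<open>separated\<close> is annihilated by all of their kernels but not
  by \<open>L m a b\<close>.\<close>

lemma degree_f_eq:
  assumes "occurs m a" "occurs m b"
  shows "degree (f m a b) = m"
  using assms
proof (induction m rule: less_induct)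
  case (less m)
  show ?case
  proof (rule ccontr)
    assume "degree (f m a b) \<noteq> m"
    then have lt: "degree (f m a b) < m" using degree_f[OF less.prems] by simp
    then obtain m' where m': "m = Suc m'" by (cases m) auto
    have "degree (f j a b) = j" "f j a b \<noteq> 0" if "j \<le> m'" for j
      using less.IH[of j] f_1[of j a b] less.prems occurs_le that by (auto simp: m')
    then obtain c where "f m a b = (\<Sum>j\<le>m'. smult (c j) (f j a b))"
      using poly_triangular[of m' "\<lambda>j. f j a b" "f m a b"] lt m' by auto
    then have L: "L m a b = mcomb {..m'} c (\<lambda>j. L j a b)"
      unfolding L_def by (simp only: poly_kernel_sum_smult)
    obtain \<Phi> where \<Phi>: "L m a b \<odot> \<Phi> \<noteq> 0" "\<And>i. occurs i a \<Longrightarrow> occurs i b \<Longrightarrow> i \<noteq> m \<Longrightarrow> L i a b \<odot> \<Phi> = 0"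
      using separated[OF less.prems] unfolding L_def by blast
    have "L m a b \<odot> \<Phi> = 0"
      unfolding L mcomb_mprod using less.prems occurs_le m' by (intro mcomb_0 \<Phi>(2)) auto
    with \<Phi>(1) show False by simp
  qed
qed

lemma occurs_self: "occurs s a \<Longrightarrow> occurs s s"
  by (simp add: occurs_def)

text \<open>Exact degrees make the \<open>f i a b\<close> a triangular basis, and the normalization
  \<open>f_1\<close> turns the value at \<open>1\<close> into the sum of the coefficients.\<close>

lemma poly_kernel_expansion:
  assumes "occurs m a" "occurs m b" "degree p \<le> m"
  shows "\<exists>c. poly p 1 = (\<Sum>i\<le>m. c i) \<and> poly_kernel a b p = mcomb {..m} c (\<lambda>i. L i a b)"
proof -
  have "degree (f j a b) = j" "f j a b \<noteq> 0" if "j \<le> m" for j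
    using degree_f_eq[of j a b] f_1[of j a b] assms occurs_le that by auto
  then obtain c where c: "p = (\<Sum>j\<le>m. smult (c j) (f j a b))"
    using poly_triangular[of m "\<lambda>j. f j a b" p] assms by auto
  then have "poly p 1 = (\<Sum>i\<le>m. c i)"
    using f_1 assms occurs_le by (simp add: poly_sum)
  moreover from c have "poly_kernel a b p = mcomb {..m} c (\<lambda>i. L i a b)"
    unfolding L_def by (simp only: poly_kernel_sum_smult)
  ultimately show ?thesis by blast
qed

text \<open>The substitute for Schur's lemma: after expansion of the kernel, orthogonality leaves
  only the term \<open>i = s\<close>.\<close>

lemma poly_kernel_L:
  assumes "occurs m b" "occurs m d" "degree p \<le> m" "occurs s a" "occurs s b" "s \<le> m"
  shows "\<exists>c. poly_kernel b d p \<odot> L s a b = c \<cdot> (L s b d \<odot> L s a b)"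
proof -
  obtain c where c: "poly_kernel b d p = mcomb {..m} c (\<lambda>i. L i b d)"
    using poly_kernel_expansion assms by blast
  have "poly_kernel b d p \<odot> L s a b = c s \<cdot> (L s b d \<odot> L s a b)"
    unfolding c mcomb_mprod
    by (rule mcomb_single) (use assms orthogonal occurs_le in \<open>auto simp: L_def\<close>)
  then show ?thesis by blast
qed

text \<open>The coefficients of the identity sum to its diagonal value \<open>1\<close>, and
  multiplication by \<open>L i a r\<close> isolates \<open>c i\<close>.\<close>

lemma idmat_expansion:
  assumes "occurs r r"
  shows "\<exists>c. (\<Sum>i\<le>r. c i) = 1 \<and>
    (\<forall>i a. i \<le> r \<longrightarrow> occurs i a \<longrightarrow> L i a r = c i \<cdot> (L i r r \<odot> L i a r))"
proof -
  have "r \<le> n" using assms by (simp add: occurs_def)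
  then obtain p where p: "degree p \<le> r" "poly p 1 = 1" "idmat r = poly_kernel r r p"
    using idmat_eq_poly_kernel by blast
  obtain c where c: "poly p 1 = (\<Sum>i\<le>r. c i)" "poly_kernel r r p = mcomb {..r} c (\<lambda>i. L i r r)"
    using poly_kernel_expansion[OF assms assms p(1)] by blast
  have "L i a r = c i \<cdot> (L i r r \<odot> L i a r)" if "i \<le> r" "occurs i a" for i a
  proof -
    have "L i a r = mcomb {..r} c (\<lambda>i. L i r r) \<odot> L i a r"
      unfolding c(2)[symmetric] p(3)[symmetric] by (simp add: L_def idmat_poly_kernel)
    also have "\<dots> = c i \<cdot> (L i r r \<odot> L i a r)"
      unfolding mcomb_mprod
      by (rule mcomb_single) (use that assms orthogonal occurs_le in \<open>auto simp: L_def\<close>)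
    finally show ?thesis .
  qed
  then show ?thesis using c(1) p(2) by metis
qed

text \<open>\<open>D\<close> is a combination of the \<open>L i a j\<close> with
  \<open>i \<le> j\<close>. Of these \<open>\<Phi>\<close> can survive only \<open>i = m\<close>, an
  index that is absent when \<open>j < m\<close>.\<close>

lemma rest_separated:
  assumes "occurs j a" and "\<And>i. occurs i a \<Longrightarrow> occurs i j \<Longrightarrow> i \<noteq> m \<Longrightarrow> L i a j \<odot> \<Phi> = 0"
  shows "\<exists>d. rest a j \<odot> \<Phi> = d \<cdot> (L m a j \<odot> \<Phi>) \<and> (j < m \<longrightarrow> d = 0)"
proof -
  have jj: "occurs j j" using assms(1) by (auto simp: occurs_def)
  obtain c where c: "rest a j = mcomb {..j} c (\<lambda>i. L i a j)"
    unfolding rest_eq_poly_kernel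
    using poly_kernel_expansion[OF assms(1) jj, of "scaled_poly j j"] degree_scaled_poly by auto
  show ?thesis
  proof (cases "j < m")
    case True
    then have "rest a j \<odot> \<Phi> = 0" unfolding c mcomb_mprod
      using assms jj occurs_le by (intro mcomb_0 assms(2)) auto
    then show ?thesis by (intro exI[of _ 0]) simp
  next
    case False
    then have "rest a j \<odot> \<Phi> = c m \<cdot> (L m a j \<odot> \<Phi>)"
      unfolding c mcomb_mprod
      by (intro mcomb_single assms(2)) (use assms jj occurs_le in auto)
    then show ?thesis using False by blast
  qed
qed

section \<open>The products \<open>U E D\<close> and the composition constant\<close>

lemma eigenvalue:
  assumes "occurs s s"
  shows "\<exists>\<epsilon>. \<epsilon> \<noteq> 0 \<and> (\<forall>a. occurs s a \<longrightarrow> L s s s \<odot> L s a s = \<epsilon> \<cdot> L s a s)"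
proof -
  obtain c where c: "\<And>a. occurs s a \<Longrightarrow> L s a s = c s \<cdot> (L s s s \<odot> L s a s)"
    using idmat_expansion[OF assms] by blast
  \<comment> \<open>If \<open>c s\<close> were zero, so would be \<open>L s s s\<close>. The
    eigenvalue is \<open>1 / c s\<close>, the same for every \<open>a\<close>.\<close>
  have "c s \<noteq> 0" using c[OF assms] L_nonzero[OF assms assms] by auto
  moreover have "L s s s \<odot> L s a s = (1 / c s) \<cdot> L s a s" if "occurs s a" for a
  proof -
    have "(1 / c s) \<cdot> L s a s = (1 / c s) \<cdot> c s \<cdot> (L s s s \<odot> L s a s)" using c[OF that] by simp
    then show ?thesis using \<open>c s \<noteq> 0\<close> by simp
  qed
  ultimately show ?thesis by (intro exI[of _ "1 / c s"]) auto
qed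

text \<open>\<open>U E D\<close> is a combination of the \<open>L i a b\<close> with
  \<open>i \<le> s\<close>. For \<open>i < s\<close>, a test matrix of component \<open>i\<close> is
  sent by \<open>D\<close> to a multiple of \<open>L i a s \<odot> \<Phi>\<close>, which
  \<open>E\<close> annihilates; so \<open>c i = 0\<close>, and the last coefficient is the value at
  \<open>1\<close>.\<close>

lemma incl_L_rest:
  assumes "occurs s s"
  shows "\<exists>h. \<forall>a b. occurs s a \<longrightarrow> occurs s b \<longrightarrow>
    incl s b \<odot> L s s s \<odot> rest a s = (between 0 s b * h a) \<cdot> L s a b"
proof -
  obtain h where h: "\<And>a b. b \<le> n \<Longrightarrow> \<exists>g. degree g \<le> s \<and> poly g 1 = between 0 s b * h a \<and>
      incl s b \<odot> L s s s \<odot> rest a s = poly_kernel a b g"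
    using incl_poly_kernel_rest[OF degree_f[OF assms assms]] unfolding L_def by blast
  have "incl s b \<odot> L s s s \<odot> rest a s = (between 0 s b * h a) \<cdot> L s a b" (is "?M = _")
    if a: "occurs s a" and b: "occurs s b" for a b
  proof -
    have "b \<le> n" using b by (simp add: occurs_def)
    then obtain g where g: "degree g \<le> s" "poly g 1 = between 0 s b * h a" "?M = poly_kernel a b g"
      using h by blast
    obtain c where c: "poly g 1 = (\<Sum>i\<le>s. c i)" "?M = mcomb {..s} c (\<lambda>i. L i a b)"
      using poly_kernel_expansion[OF a b g(1)] g(3) by auto
    have "c i = 0" if "i < s" for i
    proof -
      have i: "occurs i a" "occurs i b" "occurs i s" "occurs s s"
        using that a b assms occurs_le by auto
      obtain \<Phi> where \<Phi>: "L i a b \<odot> \<Phi> \<noteq> 0"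
          "\<And>j b'. occurs j a \<Longrightarrow> occurs j b' \<Longrightarrow> j \<noteq> i \<Longrightarrow> L j a b' \<odot> \<Phi> = 0"
        using separated[OF i(1,2)] unfolding L_def by blast
      obtain d where d: "rest a s \<odot> \<Phi> = d \<cdot> (L i a s \<odot> \<Phi>)"
        using rest_separated[OF a \<Phi>(2)] by blast
      have "L s s s \<odot> L i a s = 0"
        using orthogonal[of s s s i a] i that by (simp add: L_def)
      then have "?M \<odot> \<Phi> = 0"
        by (simp add: mprod_assoc d) (simp flip: mprod_assoc)
      moreover have "?M \<odot> \<Phi> = c i \<cdot> (L i a b \<odot> \<Phi>)"
        unfolding c(2) mcomb_mprod
        by (intro mcomb_single \<Phi>(2)) (use a b that occurs_le in auto)
      ultimately show ?thesis using \<Phi>(1) by (simp add: mscale_eq_0_iff)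
    qed
    then have c0: "c i = 0" if "i \<in> {..s} - {s}" for i using that by auto
    have "(\<Sum>i\<le>s. c i) = (\<Sum>i\<in>{s}. c i)"
      using c0 by (intro sum.mono_neutral_right) auto
    moreover have "(\<Sum>i\<le>s. c i * L i a b y x) = (\<Sum>i\<in>{s}. c i * L i a b y x)" for y x
      using c0 by (intro sum.mono_neutral_right) auto
    ultimately show ?thesis using c g(2) by (simp add: mcomb_def mscale_def)
  qed
  then show ?thesis by blast
qed

text \<open>All \<open>D_j\<close> with \<open>j < s\<close> annihilate a test matrix
  \<open>\<Phi>\<close> of component \<open>s\<close>, so
  \<open>L s a a \<odot> \<Phi> \<noteq> 0\<close> forces \<open>U D \<Phi> \<noteq> 0\<close>.
  Inserting \<open>E\<close> only multiplies by a nonzero eigenvalue.\<close>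

lemma incl_L_rest_nonzero:
  assumes "occurs s a"
  shows "incl s a \<odot> L s s s \<odot> rest a s \<noteq> 0"
proof -
  have s: "occurs s s" using assms by (auto simp: occurs_def)
  obtain \<Phi> where \<Phi>: "L s a a \<odot> \<Phi> \<noteq> 0"
      "\<And>j b'. occurs j a \<Longrightarrow> occurs j b' \<Longrightarrow> j \<noteq> s \<Longrightarrow> L j a b' \<odot> \<Phi> = 0"
    using separated[OF assms assms] unfolding L_def by blast
  obtain b where b: "L s a a = mcomb {..s} b (\<lambda>j. incl j a \<odot> rest a j)"
    using poly_kernel_decomp[OF degree_f[OF assms assms]] unfolding L_def by blast
  have "rest a j \<odot> \<Phi> = 0" if "j < s" for j
    using rest_separated[OF occurs_le[OF assms], of j s \<Phi>] \<Phi>(2) occurs_le[OF s] that by auto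
  then have "L s a a \<odot> \<Phi> = b s \<cdot> (incl s a \<odot> rest a s \<odot> \<Phi>)"
    unfolding b mcomb_mprod by (intro mcomb_single) (auto simp: mprod_assoc)
  then have nz: "incl s a \<odot> (rest a s \<odot> \<Phi>) \<noteq> 0" using \<Phi>(1) by (auto simp: mprod_assoc)
  obtain d where d: "rest a s \<odot> \<Phi> = d \<cdot> (L s a s \<odot> \<Phi>)"
    using rest_separated[OF assms \<Phi>(2)] by blast
  obtain \<epsilon> where \<epsilon>: "\<epsilon> \<noteq> 0" "L s s s \<odot> L s a s = \<epsilon> \<cdot> L s a s"
    using eigenvalue[OF s] assms by blast
  have "L s s s \<odot> (rest a s \<odot> \<Phi>) = \<epsilon> \<cdot> (rest a s \<odot> \<Phi>)"
    unfolding d using \<epsilon>(2) by (simp flip: mprod_assoc) (simp add: mult.commute)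
  then have "incl s a \<odot> L s s s \<odot> rest a s \<odot> \<Phi> = \<epsilon> \<cdot> (incl s a \<odot> (rest a s \<odot> \<Phi>))"
    by (simp add: mprod_assoc)
  then show ?thesis using nz \<epsilon>(1) by (auto simp: mscale_eq_0_iff)
qed

lemma L_mprod_L_eigenvalue:
  assumes "occurs s s"
  shows "\<exists>\<epsilon>. \<epsilon> \<noteq> 0 \<and> (\<forall>a b d. occurs s a \<longrightarrow> occurs s b \<longrightarrow> occurs s d \<longrightarrow>
    L s b d \<odot> L s a b = (\<epsilon> * of_nat (card (X b)) / of_nat (card (X s))) \<cdot> L s a d)"
proof -
  let ?E = "L s s s"
  obtain \<epsilon> where \<epsilon>: "\<epsilon> \<noteq> 0" "?E \<odot> ?E = \<epsilon> \<cdot> ?E"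
    using eigenvalue[OF assms] assms by blast
  obtain h where h: "\<And>a b. occurs s a \<Longrightarrow> occurs s b \<Longrightarrow>
      incl s b \<odot> ?E \<odot> rest a s = (between 0 s b * h a) \<cdot> L s a b"
    using incl_L_rest[OF assms] by blast
  have nz: "between 0 s b \<noteq> 0" "h b \<noteq> 0" if "occurs s b" for b
    using incl_L_rest_nonzero[OF that] h[OF that that] by auto
  have X_s: "card (X s) \<noteq> 0"
    using exists_subspace[of s] finite_subspaces assms by (auto simp: occurs_def)
  have "L s b d \<odot> L s a b = (\<epsilon> * of_nat (card (X b)) / of_nat (card (X s))) \<cdot> L s a d"
    if a: "occurs s a" and b: "occurs s b" and d: "occurs s d" for a b d
  proof -
    obtain p where p: "degree p \<le> s" "rest b s \<odot> incl s b = poly_kernel s s p"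
      using rest_incl by blast
    obtain m where m: "poly_kernel s s p \<odot> ?E = m \<cdot> (?E \<odot> ?E)"
      using poly_kernel_L[OF assms assms p(1) assms assms] by blast
    define \<mu> where "\<mu> = m * \<epsilon>"
    have \<mu>: "rest b s \<odot> incl s b \<odot> ?E = \<mu> \<cdot> ?E"
      using m by (simp add: p(2) \<epsilon>(2) \<mu>_def)
    \<comment> \<open>The trace of a polynomial kernel is the number of subspaces times the value at
      \<open>1\<close>, so cyclicity of the trace determines \<open>\<mu>\<close>.\<close>
    have "of_nat (card (X b)) * (between 0 s b * h b) = mtrace (incl s b \<odot> ?E \<odot> rest b s)"
      unfolding h[OF b b] by (simp add: L_def mtrace_poly_kernel f_1 b)
    also have "\<dots> = mtrace (rest b s \<odot> incl s b \<odot> ?E)"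
      by (subst mtrace_mprod_commute) (simp add: mprod_assoc)
    also have "\<dots> = \<mu> * of_nat (card (X s))"
      unfolding \<mu> by (simp add: L_def mtrace_poly_kernel f_1 assms)
    finally have tr: "of_nat (card (X b)) * (between 0 s b * h b) = \<mu> * of_nat (card (X s))" .
    define C where "C = (between 0 s d * h b) * (between 0 s b * h a)"
    have "C \<cdot> (L s b d \<odot> L s a b)
        = (incl s d \<odot> ?E \<odot> rest b s) \<odot> (incl s b \<odot> ?E \<odot> rest a s)"
      unfolding h[OF b d] h[OF a b] by (simp add: C_def mult.commute)
    also have "\<dots> = incl s d \<odot> (?E \<odot> (rest b s \<odot> incl s b \<odot> ?E)) \<odot> rest a s"
      by (simp add: mprod_assoc)
    also have "\<dots> = (\<mu> * \<epsilon>) \<cdot> (incl s d \<odot> ?E \<odot> rest a s)"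
      unfolding \<mu> by (simp add: \<epsilon>(2))
    also have "\<dots> = (\<mu> * \<epsilon> * (between 0 s d * h a)) \<cdot> L s a d"
      unfolding h[OF a d] by simp
    \<comment> \<open>The trace identity replaces \<open>\<mu>\<close> and supplies the factors
      \<open>between 0 s b * h b\<close> of \<open>C\<close>.\<close>
    also have "\<mu> * \<epsilon> * (between 0 s d * h a) = C * (\<epsilon> * of_nat (card (X b)) / of_nat (card (X s)))"
      using tr X_s by (simp add: C_def field_simps)
    finally have "C \<cdot> (L s b d \<odot> L s a b)
        = C \<cdot> (\<epsilon> * of_nat (card (X b)) / of_nat (card (X s))) \<cdot> L s a d" by simp
    moreover have "C \<noteq> 0" using nz a b d by (simp add: C_def)
    ultimately show ?thesis by (rule mscale_left_imp_eq)
  qed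
  with \<epsilon>(1) show ?thesis by blast
qed

text \<open>Each coefficient of the identity of \<open>V_r\<close> is \<open>\<delta> i\<close>
  divided by \<open>card (X r)\<close>. That they sum to \<open>1\<close> gives the partial sums of
  \<open>\<delta>\<close>, and \<open>\<delta> s\<close> is the difference of two consecutive
  ones.\<close>

theorem L_mprod_L:
  assumes "occurs s a" "occurs s b" "occurs s d"
  shows "L s b d \<odot> L s a b
    = (of_nat (card (X b)) / (of_nat (card (X s)) - (if s = 0 then 0 else of_nat (card (X (s - 1)))))) \<cdot> L s a d"
proof -
  define eig where "eig i e \<longleftrightarrow> e \<noteq> 0 \<and> (\<forall>a b d. occurs i a \<longrightarrow> occurs i b \<longrightarrow> occurs i d \<longrightarrow>
      L i b d \<odot> L i a b = (e * of_nat (card (X b)) / of_nat (card (X i))) \<cdot> L i a d)" for i e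
  have "\<exists>e. eig i e" if "occurs i i" for i
    using L_mprod_L_eigenvalue[OF that] unfolding eig_def .
  then obtain \<epsilon> where "\<And>i. occurs i i \<Longrightarrow> eig i (\<epsilon> i)" by metis
  then obtain \<epsilon> where \<epsilon>0: "\<And>i. occurs i i \<Longrightarrow> \<epsilon> i \<noteq> 0"
    and \<epsilon>: "\<And>i a b d. \<lbrakk>occurs i a; occurs i b; occurs i d\<rbrakk> \<Longrightarrow>
      L i b d \<odot> L i a b = (\<epsilon> i * of_nat (card (X b)) / of_nat (card (X i))) \<cdot> L i a d"
    unfolding eig_def using occurs_self by blast
  have X0: "card (X r) \<noteq> 0" if "r \<le> n" for r
    using exists_subspace[OF that] finite_subspaces by auto
  \<comment> \<open>\<open>\<delta> i\<close> is the dimension of the irreducible representation \<open>\<pi>\<^sub>i\<close>.\<close>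
  define \<delta> :: "nat \<Rightarrow> complex" where "\<delta> i = of_nat (card (X i)) / \<epsilon> i" for i
  have sum_\<delta>: "(\<Sum>i\<le>r. \<delta> i) = of_nat (card (X r))" if r: "occurs r r" for r
  proof -
    have Xr: "card (X r) \<noteq> 0" using r by (intro X0) (simp add: occurs_def)
    obtain c where c: "(\<Sum>i\<le>r. c i) = 1"
        "\<And>i. i \<le> r \<Longrightarrow> occurs i r \<Longrightarrow> L i r r = c i \<cdot> (L i r r \<odot> L i r r)"
      using idmat_expansion[OF r] by blast
    have "\<delta> i = c i * of_nat (card (X r))" if "i \<le> r" for i
    proof -
      have i: "occurs i r" "occurs i i" "card (X i) \<noteq> 0"
        using that r X0[of i] by (auto simp: occurs_def)
      have "1 \<cdot> L i r r = (c i * (\<epsilon> i * of_nat (card (X r)) / of_nat (card (X i)))) \<cdot> L i r r"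
        using c(2)[OF that i(1)] unfolding \<epsilon>[OF i(1) i(1) i(1)] mscale_mscale mscale_1 .
      then have "1 = c i * (\<epsilon> i * of_nat (card (X r)) / of_nat (card (X i)))"
        using L_nonzero[OF i(1) i(1)] mscale_cancel by blast
      then show ?thesis using \<epsilon>0[OF i(2)] i(3) by (simp add: \<delta>_def field_simps)
    qed
    then have "(\<Sum>i\<le>r. \<delta> i) = (\<Sum>i\<le>r. c i) * of_nat (card (X r))"
      by (simp add: sum_distrib_right)
    then show ?thesis by (simp add: c(1))
  qed
  have s: "occurs s s" using assms(1) by (simp add: occurs_def)
  have "\<delta> s = of_nat (card (X s)) - (if s = 0 then 0 else of_nat (card (X (s - 1))))"
  proof (cases s)
    case 0
    then show ?thesis using sum_\<delta>[OF s] by simp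
  next
    case (Suc s')
    then show ?thesis using sum_\<delta>[OF s] sum_\<delta>[of s'] s by (simp add: occurs_def algebra_simps)
  qed
  moreover have "\<epsilon> s * of_nat (card (X b)) / of_nat (card (X s)) = of_nat (card (X b)) / \<delta> s"
    by (simp add: \<delta>_def)
  ultimately show ?thesis unfolding \<epsilon>[OF assms] by (simp only:)
qed

end

section \<open>Composition of the normalized component maps\<close>

lemma q_pochhammer_Suc: "q_pochhammer u p (Suc k) = q_pochhammer u p k * (1 - p ^ k * u)"
  by (simp add: q_pochhammer_def)

text \<open>Each factor is \<open>- (p ^ i) * (1 - p ^ (m - i))\<close>, and the second factors are
  the last \<open>r\<close> factors of \<open>q_pochhammer p p m\<close>. Division is avoided since
  Pochhammer products may vanish in a general field.\<close>

lemma prod_power_diff_q_pochhammer: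
  fixes p :: "'a::field"
  assumes "r \<le> m"
  shows "(\<Prod>i<r. p ^ m - p ^ i) * q_pochhammer p p (m - r) = (\<Prod>i<r. - (p ^ i)) * q_pochhammer p p m"
  using assms
proof (induction r)
  case 0
  then show ?case by simp
next
  case (Suc r)
  define k where "k = m - Suc r"
  have k: "m - r = Suc k" "m = r + Suc k" using Suc.prems by (auto simp: k_def)
  have "p ^ m - p ^ r = - (p ^ r) * (1 - p ^ k * p)"
    by (simp add: k(2) power_add algebra_simps)
  then have "(\<Prod>i<Suc r. p ^ m - p ^ i) * q_pochhammer p p k
      = - (p ^ r) * ((\<Prod>i<r. p ^ m - p ^ i) * q_pochhammer p p (m - r))"
    by (simp add: k(1) q_pochhammer_Suc algebra_simps)
  then show ?case using Suc.IH Suc.prems by (simp add: k_def)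
qed

context finite_field_space
begin

lemma card_grassmannian:
  assumes "r \<le> n"
  shows "of_nat (card (X r)) = q_binomial Q n r"
proof -
  have poch: "q_pochhammer Q Q k \<noteq> 0" for k
    using Q_power_eq_iff[of 0 "Suc _"] by (auto simp: q_pochhammer_def mult.commute)
  have nz: "(\<Prod>i<r. - (Q ^ i)) \<noteq> 0" by simp
  have "(\<Prod>i<r. Q ^ r - Q ^ i) = (\<Prod>i<r. - (Q ^ i)) * q_pochhammer Q Q r"
    using prod_power_diff_q_pochhammer[of r r Q] by (simp add: q_pochhammer_def)
  moreover have "(\<Prod>i<r. Q ^ n - Q ^ i) = (\<Prod>i<r. - (Q ^ i)) * q_pochhammer Q Q n / q_pochhammer Q Q (n - r)"
    using prod_power_diff_q_pochhammer[OF assms, of Q] poch by (simp add: eq_divide_eq)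
  ultimately have "between 0 r n = q_binomial Q n r"
    using nz poch by (simp add: between_def q_binomial_def)
  then show ?thesis
    using card_subspaces_of[OF subspace_UNIV, of r] by (simp add: dim_space del: dim_UNIV)
qed

section \<open>Application of kernels to functions\<close>

lemma codist_eq:
  assumes y: "y \<in> X b" and x: "x \<in> X a"
  shows "codist scale y x \<in> codist_range n a b"
    and "1 / Q ^ codist scale y x = Q ^ dim (y \<inter> x) / Q ^ b"
proof -
  have sub: "subspace y" "subspace x" and d: "dim y = b" "dim x = a"
    using assms by (auto simp: grassmannian_def)
  have c: "codist scale y x = b - dim (y \<inter> x)" by (simp add: codist_def d)
  have le: "dim (y \<inter> x) \<le> a" "dim (y \<inter> x) \<le> b"
    using dim_subset[of "y \<inter> x"] d by auto
  have "dim {u + v |u v. u \<in> y \<and> v \<in> x} \<le> n"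
    using dim_subset[OF subset_UNIV] unfolding dim_space .
  moreover have "dim {u + v |u v. u \<in> y \<and> v \<in> x} + dim (y \<inter> x) = b + a"
    using dim_sums_Int[OF sub] d by simp
  ultimately show "codist scale y x \<in> codist_range n a b"
    using le by (auto simp: c codist_range_def)
  show "1 / Q ^ codist scale y x = Q ^ dim (y \<inter> x) / Q ^ b"
    using le(2) by (simp add: c power_diff)
qed

text \<open>A function is encoded as a matrix with equal columns, so that applying a map becomes
  \<open>\<odot>\<close>. The kernel prescribes \<open>T \<phi>\<close> on \<open>X b\<close> only;
  membership in \<open>fun_space scale b\<close> settles the rest.\<close>

lemma poly_kernel_mprod_vector:
  assumes "is_kernel scale a b k T" "\<forall>t\<in>codist_range n a b. poly p (1 / Q ^ t) = k t"
    and "\<phi> \<in> fun_space scale a" "T \<phi> \<in> fun_space scale b"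
  shows "poly_kernel a b p \<odot> (\<lambda>u _. \<phi> u) = (\<lambda>y _. T \<phi> y)"
proof (intro ext)
  fix y z
  show "(poly_kernel a b p \<odot> (\<lambda>u _. \<phi> u)) y z = T \<phi> y"
  proof (cases "y \<in> X b")
    case True
    have "(poly_kernel a b p \<odot> (\<lambda>u _. \<phi> u)) y z = (\<Sum>u\<in>X a. poly_kernel a b p y u * \<phi> u)"
      unfolding mprod_def
      by (rule sum.mono_neutral_right) (auto simp: poly_kernel_def intro: finite_subspaces)
    also have "\<dots> = (\<Sum>u\<in>X a. k (codist scale y u) * \<phi> u)"
      using codist_eq[OF True] assms(2) True
      by (intro sum.cong) (force simp: poly_kernel_def)+
    finally show ?thesis using assms(1,3) True by (simp add: is_kernel_def)
  next
    case False
    then show ?thesis using assms(4) by (simp add: mprod_def poly_kernel_def fun_space_def)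
  qed
qed

end

interpretation fscale: vector_space "fscale :: complex \<Rightarrow> ('x \<Rightarrow> complex) \<Rightarrow> 'x \<Rightarrow> complex"
  by (rule vector_space_fscale)

lemma sum_fun_apply: "(\<Sum>i\<in>I. g i) x = (\<Sum>i\<in>I. (g i :: 'x \<Rightarrow> complex) x)"
  by (induction I rule: infinite_finite_induct) auto

lemma fun_inner_sum:
  "fun_inner scale r (\<Sum>i\<in>I. \<phi> i) \<psi> = (\<Sum>i\<in>I. fun_inner scale r (\<phi> i) \<psi>)"
  by (simp add: fun_inner_def sum_fun_apply sum_distrib_right) (rule sum.swap)

locale normalized_component_maps = finite_field_space +
  fixes V :: "nat \<Rightarrow> nat \<Rightarrow> ('b set \<Rightarrow> complex) set"
    and \<Lambda> :: "nat \<Rightarrow> nat \<Rightarrow> nat \<Rightarrow> ('b set \<Rightarrow> complex) \<Rightarrow> ('b set \<Rightarrow> complex)"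
  assumes decomposition: "r \<le> n \<Longrightarrow> orthogonal_sum scale r (min r (n - r)) (V r)"
    and normalized: "\<lbrakk>occurs s a; occurs s b\<rbrakk> \<Longrightarrow> normalized_component_map scale n V s a b (\<Lambda> s a b)"
begin

section \<open>Action of the normalized maps on the components\<close>

lemma occurs_iff: "occurs s a \<longleftrightarrow> a \<le> n \<and> s \<le> min a (n - a)"
  by (auto simp: occurs_def)

lemma V_subset_fun_space:
  assumes "occurs s a"
  shows "V a s \<subseteq> fun_space scale a"
proof
  fix \<phi> assume \<phi>: "\<phi> \<in> V a s"
  let ?m = "min a (n - a)" and ?g = "\<lambda>i. if i = s then \<phi> else 0"
  have dec: "orthogonal_sum scale a ?m (V a)" and s: "s \<le> ?m"
    using decomposition assms by (auto simp: occurs_iff)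
  have "?g i \<in> V a i" if "i \<le> ?m" for i
    using dec that \<phi> by (auto simp: orthogonal_sum_def intro: fscale.subspace_0)
  then have "(\<Sum>i\<le>?m. ?g i) \<in> fun_space scale a"
    using dec unfolding orthogonal_sum_def by blast
  then show "\<phi> \<in> fun_space scale a" using s by (simp add: sum.delta)
qed

lemma V_orthogonal:
  assumes "occurs i a" "occurs j a" "i \<noteq> j" "\<phi> \<in> V a i" "\<psi> \<in> V a j"
  shows "fun_inner scale a \<phi> \<psi> = 0"
proof -
  have "i \<le> min a (n - a)" "j \<le> min a (n - a)" "a \<le> n" using assms(1,2) by (auto simp: occurs_iff)
  then show ?thesis using decomposition[of a] assms(3-5) unfolding orthogonal_sum_def by blast
qed

lemma component_map:
  assumes "occurs s a" "occurs s b"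
  shows "component_map scale V s a b (\<Lambda> s a b)"
  using normalized[OF assms] by (simp add: normalized_component_map_def)

lemma vanishes:
  assumes "occurs s a" "occurs s b" "\<phi> \<in> fun_space scale a" "\<And>\<psi>. \<psi> \<in> V a s \<Longrightarrow> fun_inner scale a \<phi> \<psi> = 0"
  shows "\<Lambda> s a b \<phi> = 0"
  using component_map[OF assms(1,2)] assms(3,4) by (simp add: component_map_def)

lemma vanishes_V:
  assumes "occurs i a" "occurs i b" "occurs j a" "i \<noteq> j" "\<phi> \<in> V a j"
  shows "\<Lambda> i a b \<phi> = 0"
proof (rule vanishes[OF assms(1,2)])
  show "\<phi> \<in> fun_space scale a" using V_subset_fun_space assms by blast
  show "fun_inner scale a \<phi> \<psi> = 0" if "\<psi> \<in> V a i" for \<psi>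
    using V_orthogonal[of j a i] assms that by blast
qed

text \<open>A component map is known to send \<open>V a s\<close> into \<open>V b s\<close>. The
  remaining components of \<open>\<phi>\<close> add up to a function orthogonal to
  \<open>V a s\<close>, which is mapped to zero.\<close>

lemma \<Lambda>_in_V:
  assumes sa: "occurs s a" and sb: "occurs s b" and \<phi>: "\<phi> \<in> fun_space scale a"
  shows "\<Lambda> s a b \<phi> \<in> V b s"
proof -
  let ?m = "min a (n - a)"
  have dec: "orthogonal_sum scale a ?m (V a)" and s: "s \<le> ?m"
    using decomposition sa by (auto simp: occurs_iff)
  obtain \<phi>' where \<phi>': "\<phi> = (\<Sum>i\<le>?m. \<phi>' i)" "\<And>i. i \<le> ?m \<Longrightarrow> \<phi>' i \<in> V a i"
    using dec \<phi> unfolding orthogonal_sum_def by blast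
  define \<rho> where "\<rho> = (\<Sum>i\<in>{..?m} - {s}. \<phi>' i)"
  have eq: "\<phi> = \<phi>' s + \<rho>" using s by (simp add: \<phi>'(1) \<rho>_def sum.remove)
  have in_space: "\<phi>' i \<in> fun_space scale a" if "i \<le> ?m" for i
    using \<phi>'(2)[OF that] V_subset_fun_space[of i a] sa that by (auto simp: occurs_iff)
  have \<rho>: "\<rho> \<in> fun_space scale a"
    using in_space by (auto simp: \<rho>_def fun_space_def sum_fun_apply intro!: sum.neutral)
  have "\<Lambda> s a b \<rho> = 0"
  proof (rule vanishes[OF sa sb \<rho>])
    show "fun_inner scale a \<rho> \<psi> = 0" if "\<psi> \<in> V a s" for \<psi>
      unfolding \<rho>_def fun_inner_sum
    proof (intro sum.neutral ballI)
      fix i assume i: "i \<in> {..?m} - {s}"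
      then have "occurs i a" using sa by (auto simp: occurs_iff)
      then show "fun_inner scale a (\<phi>' i) \<psi> = 0" using V_orthogonal \<phi>'(2) that i sa by blast
    qed
  qed
  moreover have "\<Lambda> s a b (\<phi>' s + \<rho>) = \<Lambda> s a b (\<phi>' s) + \<Lambda> s a b \<rho>"
    using component_map[OF sa sb] in_space[OF s] \<rho> by (simp add: component_map_def linear_map_on_def)
  ultimately have "\<Lambda> s a b \<phi> = \<Lambda> s a b (\<phi>' s)" using eq by simp
  then show ?thesis
    using component_map[OF sa sb] \<phi>'(2)[OF s] by (auto simp: component_map_def)
qed

lemma kernels_exist:
  "\<exists>f. \<forall>s a b. occurs s a \<longrightarrow> occurs s b \<longrightarrow> degree (f s a b) \<le> s \<and> poly (f s a b) 1 = 1 \<and>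
    (\<forall>\<phi>\<in>fun_space scale a. poly_kernel a b (f s a b) \<odot> (\<lambda>u _. \<phi> u) = (\<lambda>y _. \<Lambda> s a b \<phi> y))"
proof -
  have "\<exists>p. degree p \<le> s \<and> poly p 1 = 1 \<and>
      (\<forall>\<phi>\<in>fun_space scale a. poly_kernel a b p \<odot> (\<lambda>u _. \<phi> u) = (\<lambda>y _. \<Lambda> s a b \<phi> y))"
    if o: "occurs s a" "occurs s b" for s a b
  proof -
    obtain k p where "is_kernel scale a b k (\<Lambda> s a b)" "degree p \<le> s" "poly p 1 = 1"
        "\<forall>t\<in>codist_range n a b. poly p (1 / Q ^ t) = k t"
      using normalized[OF o] unfolding normalized_component_map_def card_field by blast
    then show ?thesis
      using poly_kernel_mprod_vector \<Lambda>_in_V[OF o] V_subset_fun_space[OF o(2)] by blast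
  qed
  then show ?thesis by metis
qed

theorem \<Lambda>_comp_\<Lambda>:
  assumes "occurs s a" "occurs s b" "occurs s d" "\<phi> \<in> fun_space scale a"
  shows "\<Lambda> s b d (\<Lambda> s a b \<phi>) = fscale (q_binomial Q n b /
    (q_binomial Q n s - (if s = 0 then 0 else q_binomial Q n (s - 1)))) (\<Lambda> s a d \<phi>)"
proof -
  obtain f where "\<forall>s a b. occurs s a \<longrightarrow> occurs s b \<longrightarrow> degree (f s a b) \<le> s \<and> poly (f s a b) 1 = 1 \<and>
      (\<forall>\<phi>\<in>fun_space scale a. poly_kernel a b (f s a b) \<odot> (\<lambda>u _. \<phi> u) = (\<lambda>y _. \<Lambda> s a b \<phi> y))"
    using kernels_exist ..
  then have f: "\<And>s a b. occurs s a \<Longrightarrow> occurs s b \<Longrightarrow> degree (f s a b) \<le> s"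
      "\<And>s a b. occurs s a \<Longrightarrow> occurs s b \<Longrightarrow> poly (f s a b) 1 = 1"
    and \<Lambda>: "\<And>s a b \<phi>. occurs s a \<Longrightarrow> occurs s b \<Longrightarrow> \<phi> \<in> fun_space scale a \<Longrightarrow>
      poly_kernel a b (f s a b) \<odot> (\<lambda>u _. \<phi> u) = (\<lambda>y _. \<Lambda> s a b \<phi> y)"
    by blast+
  interpret component_kernels scale Basis q n f
  proof
    fix i j a b d
    assume o: "occurs i b" "occurs i d" "occurs j a" "occurs j b" "i \<noteq> j"
    show "poly_kernel b d (f i b d) \<odot> poly_kernel a b (f j a b) = 0"
    proof (intro ext)
      fix y x
      let ?K = "poly_kernel a b (f j a b)"
      show "(poly_kernel b d (f i b d) \<odot> ?K) y x = 0 y x"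
      proof (cases "x \<in> X a")
        case True
        \<comment> \<open>The indicator of \<open>x\<close>: its image is column \<open>x\<close> of
          the kernel, so the product of kernels can be checked column by column on
          functions.\<close>
        define \<delta> where "\<delta> u = idmat a u x" for u
        have \<delta>: "\<delta> \<in> fun_space scale a" by (auto simp: fun_space_def \<delta>_def idmat_def)
        have "?K u x = \<Lambda> j a b \<delta> u" for u
          using fun_cong[OF fun_cong[OF poly_kernel_idmat[of a b "f j a b"], of u], of x]
            fun_cong[OF fun_cong[OF \<Lambda>[OF o(3,4) \<delta>], of u], of x]
          by (simp add: mprod_def \<delta>_def)
        then have "(poly_kernel b d (f i b d) \<odot> ?K) y x
            = (poly_kernel b d (f i b d) \<odot> (\<lambda>u _. \<Lambda> j a b \<delta> u)) y x"
          by (simp add: mprod_def)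
        also have "\<dots> = \<Lambda> i b d (\<Lambda> j a b \<delta>) y"
          using \<Lambda>[OF o(1,2)] \<Lambda>_in_V[OF o(3,4) \<delta>] V_subset_fun_space[OF o(4)] by (simp add: subset_iff)
        also have "\<dots> = 0"
          using vanishes_V[OF o(1,2,4,5) \<Lambda>_in_V[OF o(3,4) \<delta>]] by simp
        finally show ?thesis by simp
      next
        case False
        then show ?thesis by (simp add: mprod_def poly_kernel_def)
      qed
    qed
  next
    fix m a b
    assume o: "occurs m a" "occurs m b"
    \<comment> \<open>This \<open>\<psi>\<close> yields the test matrix, since the maps of all other
      components kill \<open>V a m\<close>.\<close>
    obtain \<psi> where \<psi>: "\<psi> \<in> V a m" "\<Lambda> m a b \<psi> \<noteq> 0"
      using component_map[OF o] by (auto simp: component_map_def)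
    have \<psi>_space: "\<psi> \<in> fun_space scale a" using \<psi>(1) V_subset_fun_space[OF o(1)] by blast
    have "poly_kernel a b (f m a b) \<odot> (\<lambda>u _. \<psi> u) \<noteq> 0"
      unfolding \<Lambda>[OF o \<psi>_space] using \<psi>(2) by (auto simp: fun_eq_iff)
    moreover have "poly_kernel a b' (f i a b') \<odot> (\<lambda>u _. \<psi> u) = 0"
      if "occurs i a" "occurs i b'" "i \<noteq> m" for i b'
      unfolding \<Lambda>[OF that(1,2) \<psi>_space] vanishes_V[OF that(1,2) o(1) that(3) \<psi>(1)]
      by (simp add: fun_eq_iff)
    ultimately show "\<exists>\<Phi>. poly_kernel a b (f m a b) \<odot> \<Phi> \<noteq> 0 \<and>
        (\<forall>i b'. occurs i a \<longrightarrow> occurs i b' \<longrightarrow> i \<noteq> m \<longrightarrow> poly_kernel a b' (f i a b') \<odot> \<Phi> = 0)"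
      by blast
  qed (rule f; assumption)+
  let ?c = "q_binomial Q n b / (q_binomial Q n s - (if s = 0 then 0 else q_binomial Q n (s - 1)))"
  have le: "s \<le> n" "b \<le> n" using assms by (auto simp: occurs_def)
  have LL: "L s b d \<odot> L s a b = ?c \<cdot> L s a d"
    using L_mprod_L[OF assms(1-3)] le by (simp add: card_grassmannian cong: if_cong)
  have mid: "\<Lambda> s a b \<phi> \<in> fun_space scale b"
    using \<Lambda>_in_V[OF assms(1,2,4)] V_subset_fun_space[OF assms(2)] by blast
  have "(\<lambda>y (_ :: 'b set). \<Lambda> s b d (\<Lambda> s a b \<phi>) y) = L s b d \<odot> L s a b \<odot> (\<lambda>u _. \<phi> u)"
    unfolding L_def mprod_assoc \<Lambda>[OF assms(1,2,4)] \<Lambda>[OF assms(2,3) mid] ..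
  also have "\<dots> = ?c \<cdot> (\<lambda>y _. \<Lambda> s a d \<phi> y)"
    unfolding LL mscale_mprod unfolding L_def \<Lambda>[OF assms(1,3,4)] ..
  finally have eq: "(\<lambda>y (_ :: 'b set). \<Lambda> s b d (\<Lambda> s a b \<phi>) y) = ?c \<cdot> (\<lambda>y _. \<Lambda> s a d \<phi> y)" .
  show ?thesis using fun_cong[OF fun_cong[OF eq]] by (simp add: mscale_def fscale_def fun_eq_iff)
qed

end

theorem theorem4p1:
  fixes scale :: "'k::{field,finite} \<Rightarrow> 'v::ab_group_add \<Rightarrow> 'v"
    and Basis :: "'v set"
    and n r1 r2 r3 s :: nat
    and q :: complex
    and scP :: "complex \<Rightarrow> 'p::ab_group_add \<Rightarrow> 'p"
    and \<pi> :: "nat \<Rightarrow> ('v \<Rightarrow> 'v) \<Rightarrow> 'p \<Rightarrow> 'p"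
    and P :: "nat \<Rightarrow> 'p set"
    and V :: "nat \<Rightarrow> nat \<Rightarrow> ('v set \<Rightarrow> complex) set"
    and \<Lambda> :: "nat \<Rightarrow> nat \<Rightarrow> nat \<Rightarrow> ('v set \<Rightarrow> complex) \<Rightarrow> ('v set \<Rightarrow> complex)"
  assumes "finite_dimensional_vector_space scale Basis"
    and "vector_space.dim scale (UNIV :: 'v set) = n"
    and "q = of_nat CARD('k)"
    and "vector_space scP"
    and "grassmann_decomposition scale n scP \<pi> P V"
    and "\<And>s a b. a \<le> n \<Longrightarrow> b \<le> n \<Longrightarrow> s \<le> rank_bound n a b \<Longrightarrow>
           normalized_component_map scale n V s a b (\<Lambda> s a b)"
    and "r1 \<le> n" and "r2 \<le> n" and "r3 \<le> n"
    and "s \<le> min (rank_bound n r1 r2) (rank_bound n r2 r3)"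
  shows "\<forall>\<phi>\<in>fun_space scale r1.
    \<Lambda> s r2 r3 (\<Lambda> s r1 r2 \<phi>) =
      fscale (q_binomial q n r2 /
               (q_binomial q n s - (if s = 0 then 0 else q_binomial q n (s - 1))))
        (\<Lambda> s r1 r3 \<phi>)"
proof -
  interpret finite_field_space scale Basis "CARD('k)" n
    using assms(1,2) by (intro finite_field_space.intro finite_field_space_axioms.intro refl)
  interpret normalized_component_maps scale Basis "CARD('k)" n V \<Lambda>
  proof
    show "orthogonal_sum scale r (min r (n - r)) (V r)" if "r \<le> n" for r
      using assms(5) that by (simp add: grassmann_decomposition_def)
    show "normalized_component_map scale n V s a b (\<Lambda> s a b)" if "occurs s a" "occurs s b" for s a b
      using that by (intro assms(6)) (auto simp: occurs_def rank_bound_def)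
  qed
  \<comment> \<open>The two rank bounds together bound \<open>s\<close> by \<open>r\<close> and
    \<open>n - r\<close> for all three dimensions, which also covers the pair \<open>r1\<close>,
    \<open>r3\<close>.\<close>
  have "occurs s r1" "occurs s r2" "occurs s r3"
    using assms(7-10) by (auto simp: occurs_def rank_bound_def)
  then show ?thesis unfolding assms(3) using \<Lambda>_comp_\<Lambda> by blast
qed

end
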